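(* Let $n\ge2$ and let $Y\in{}_n\mathrm{MPH}^{*}$ have joint Laplace transform $L_Y(s)=P(s)/Q(s)$ in minimal form. After multiplying $P$ and $Q$ by a common non-zero scalar if necessary, the leading homogeneous part $Q_{\mathrm{top}}(s)$ of $Q$ factors as a product of real linear functions with non-negative coefficients: there exist $c_0>0$, an integer $\nu\ge0$ and real numbers $\lambda_{ij}\ge0$ ($1\le i\le\nu$, $1\le j\le n$) such that $$Q_{\mathrm{top}}(s)=c_0\prod_{i=1}^{\nu}\ell_i(s),\qquad \ell_i(s)=\sum_{j=1}^n\lambda_{ij}s_j,$$ with $\nu=0$ and the empty product allowed when the minimal denominator is constant.
   Context: Let $\mathbb{R}_+^n=[0,\infty)^n$, $\langle s,x\rangle=\sum_j s_jx_j$, $\mathbf 1$ the all-ones column vector, and $\Delta(v)$ the diagonal matrix with diagonal $v$. The joint Laplace transform of a random vector $Y$ in $\mathbb{R}_+^n$ is $L_Y(s)=\mathbb{E}[e^{-\langle s,Y\rangle}]$. A transient subgenerator is a matrix $T\in\mathbb{R}^{m\times m}$ with $T_{ii}<0$, $T_{ij}\ge0$ for $i\ne j$, row sums $T\mathbf 1\le0$ componentwise, and such that the associated continuous-time Markov chain is transient, i.e. absorption is almost sure from every state (equivalently, $T$ is invertible). ${}_n\mathrm{MPH}^{*}$: random vectors $Y$ in $\mathbb{R}_+^n$ for which there exist $m\ge1$, a row vector $\alpha\in\mathbb{R}_+^{1\times m}$ with $\alpha\mathbf 1\le1$, a transient subgenerator $T\in\mathbb{R}^{m\times m}$, and an entrywise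 non-negative reward matrix $K\in\mathbb{R}_+^{m\times n}$ such that $L_Y(s)=p_0+\alpha(-T+\Delta(Ks))^{-1}\mathbf t$, where $\mathbf t=-T\mathbf 1$ and $p_0=1-\alpha\mathbf 1$. In particular $L_Y$ is a rational function of $s$. Minimal form $L_Y=P/Q$ means that $P,Q$ are real polynomials in $s_1,\dots,s_n$ with no non-constant common factor. For a non-zero real polynomial $F$ in $s_1,\dots,s_n$, its leading homogeneous part $F_{\mathrm{top}}$ is the sum of those monomial terms of $F$ whose total degree is maximal. *)

theory Defs
  imports
    "HOL-Probability.Probability"
    "HOL-Library.Poly_Mapping"
    "Jordan_Normal_Form.Gauss_Jordan_Elimination"
begin

(* Both HOL-Analysis and Jordan_Normal_Form provide vec, $ and an inner product.
   Vectors of the fixed dimension n are of type real ^ 'n; phase vectors and matrices, whose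
   dimension m is existentially quantified, are those of Jordan_Normal_Form. *)

section \<open>Real polynomials in the variables indexed by a finite type\<close>

type_synonym 'n mpoly = "('n \<Rightarrow>\<^sub>0 nat) \<Rightarrow>\<^sub>0 real"

definition mconst :: "real \<Rightarrow> 'n mpoly" where
  "mconst c = Poly_Mapping.single 0 c"

definition mvar :: "'n \<Rightarrow> 'n mpoly" where
  "mvar j = Poly_Mapping.single (Poly_Mapping.single j 1) 1"

definition meval :: "('n::finite) mpoly \<Rightarrow> real ^ 'n \<Rightarrow> real" where
  "meval F s = (\<Sum>\<mu>\<in>Poly_Mapping.keys F.
     Poly_Mapping.lookup F \<mu> * (\<Prod>j\<in>UNIV. vec_nth s j ^ Poly_Mapping.lookup \<mu> j))"

definition monom_degree :: "('n::finite \<Rightarrow>\<^sub>0 nat) \<Rightarrow> nat" where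
  "monom_degree \<mu> = (\<Sum>j\<in>UNIV. Poly_Mapping.lookup \<mu> j)"

definition total_degree :: "('n::finite) mpoly \<Rightarrow> nat" where
  "total_degree F = Max (monom_degree ` Poly_Mapping.keys F)"

(* Only meaningful for F \<noteq> 0; the value at 0 is 0. *)
definition leading_part :: "('n::finite) mpoly \<Rightarrow> 'n mpoly" where
  "leading_part F = (\<Sum>\<mu> | \<mu> \<in> Poly_Mapping.keys F \<and> monom_degree \<mu> = total_degree F.
     Poly_Mapping.single \<mu> (Poly_Mapping.lookup F \<mu>))"

definition nonneg_orthant :: "(real ^ 'n) set" where
  "nonneg_orthant = {s. \<forall>j. 0 \<le> vec_nth s j}"

(* L = P / Q is an equality of rational functions, so points where Q vanishes are left out. *)
definition minimal_form ::
    "(real ^ 'n \<Rightarrow> real) \<Rightarrow> ('n::finite) mpoly \<Rightarrow> 'n mpoly \<Rightarrow> bool" where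
  "minimal_form L P Q \<longleftrightarrow>
     Q \<noteq> 0 \<and>
     (\<forall>s\<in>nonneg_orthant. meval Q s \<noteq> 0 \<longrightarrow> L s = meval P s / meval Q s) \<and>
     (\<forall>D. D dvd P \<longrightarrow> D dvd Q \<longrightarrow> (\<exists>c. D = mconst c))"

section \<open>Multivariate phase-type distributions\<close>

definition ones_vec :: "nat \<Rightarrow> real Matrix.vec" where
  "ones_vec m = Matrix.vec m (\<lambda>_. 1)"

(* With e^{tT} the matrix exponential, (e^{tT} 1)_i is the probability that the chain with
   subgenerator T started in state i has not been absorbed by time t. *)
definition survival_prob :: "real Matrix.mat \<Rightarrow> nat \<Rightarrow> real \<Rightarrow> real" where
  "survival_prob T i t =
     suminf (\<lambda>k. t ^ k / fact k * Matrix.vec_index ((T ^\<^sub>m k) *\<^sub>v ones_vec (dim_row T)) i)"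

definition transient_subgenerator :: "nat \<Rightarrow> real Matrix.mat \<Rightarrow> bool" where
  "transient_subgenerator m T \<longleftrightarrow>
     T \<in> carrier_mat m m \<and>
     (\<forall>i<m. T $$ (i, i) < 0) \<and>
     (\<forall>i<m. \<forall>j<m. i \<noteq> j \<longrightarrow> 0 \<le> T $$ (i, j)) \<and>
     (\<forall>i<m. (\<Sum>j<m. T $$ (i, j)) \<le> 0) \<and>
     (\<forall>i<m. (survival_prob T i \<longlongrightarrow> 0) at_top)"

definition laplace_transform :: "'a measure \<Rightarrow> ('a \<Rightarrow> real ^ 'n) \<Rightarrow> real ^ 'n \<Rightarrow> real" where
  "laplace_transform M Y s = integral\<^sup>L M (\<lambda>\<omega>. exp (- inner s (Y \<omega>)))"

(* The reward matrix is given by its rows: K i is row i, so inner (K i) s = (K s)_i. *)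
definition mph_transform ::
    "nat \<Rightarrow> real Matrix.vec \<Rightarrow> real Matrix.mat \<Rightarrow> (nat \<Rightarrow> real ^ 'n) \<Rightarrow> real ^ 'n \<Rightarrow> real" where
  "mph_transform m \<alpha> T K s =
     (1 - scalar_prod \<alpha> (ones_vec m)) +
     scalar_prod \<alpha>
       (the (mat_inverse (- T + mat_diag m (\<lambda>i. inner (K i) s))) *\<^sub>v (- (T *\<^sub>v ones_vec m)))"

definition MPH_star :: "'a measure \<Rightarrow> ('a \<Rightarrow> real ^ 'n) \<Rightarrow> bool" where
  "MPH_star M Y \<longleftrightarrow>
     prob_space M \<and>
     Y \<in> borel_measurable M \<and>
     (\<forall>\<omega>\<in>space M. Y \<omega> \<in> nonneg_orthant) \<and>
     (\<exists>m \<alpha> T K.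
        1 \<le> m \<and>
        \<alpha> \<in> carrier_vec m \<and>
        (\<forall>i<m. 0 \<le> Matrix.vec_index \<alpha> i) \<and>
        scalar_prod \<alpha> (ones_vec m) \<le> 1 \<and>
        transient_subgenerator m T \<and>
        (\<forall>i<m. \<forall>j. 0 \<le> vec_nth (K i) j) \<and>
        (\<forall>s\<in>nonneg_orthant. laplace_transform M Y s = mph_transform m \<alpha> T K s))"

end

theory Submission
  imports Defs "Jordan_Normal_Form.Determinant"
begin

text \<open>
  Let \<open>D = det (-T + \<Delta>(K s))\<close>. By Cramer's rule the transform is a fraction with denominator \<open>D\<close>
  (\<open>mph_transform_rational\<close>). Expanding \<open>D\<close> over the diagonal entries gives a combination of products
  of the linear forms \<open>\<langle>K i, s\<rangle>\<close> with principal minors of \<open>-T\<close> as coefficients. The term of highest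
  degree contains all nonzero forms, and its coefficient is the principal minor of \<open>-T\<close> on the states
  without reward. This minor is not zero, since otherwise the chain could start in a set of states
  that it never leaves, not even by absorption
  (\<open>transient_subgenerator_restricted_nonsingular\<close>). Hence the leading part of \<open>D\<close> is a nonzero constant
  times a product of linear forms with non-negative coefficients
  (\<open>leading_part_det_resolvent_matrix\<close>).

  If \<open>P/Q\<close> is the minimal form, then \<open>P D = Q N\<close> for some polynomial \<open>N\<close>, and \<open>Q\<close> divides \<open>D\<close> because
  the polynomial ring is factorial (\<open>minimal_denominator_dvd\<close>). Leading parts are multiplicative, so
  the leading part of \<open>Q\<close> divides that of \<open>D\<close>. Linear forms are irreducible, and by unique
  factorization again a divisor of a product of linear forms is a constant times the product of some
  of them (\<open>dvd_prod_linear_forms\<close>). Scaling by the inverse of the constant completes the proof.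

  Most of the work is unique factorization for polynomials in a number of variables given by a type.
  It follows from Gauss's lemma (\<open>factorial_in_polys_over\<close>) by adjoining the variables one by one; the
  lemma is stated for a subring of an arbitrary commutative ring so that it can be iterated.
\<close>

section \<open>Factorization in a subring\<close>

text \<open>
  Unique factorization is proved by adjoining the variables one at a time inside the full ring of
  multivariate polynomials, so that the notions of this section are relative to a subset \<open>S\<close> of a
  commutative ring. Zero divisors are excluded inside \<open>S\<close> alone: that the full ring has none is
  itself a result of the induction on the variables.
\<close>

definition domain_in :: "'a::comm_ring_1 set \<Rightarrow> bool" where
  "domain_in S \<longleftrightarrow> 1 \<in> S \<and> (\<forall>a\<in>S. \<forall>b\<in>S. a - b \<in> S \<and> a * b \<in> S \<and> (a * b = 0 \<longrightarrow> a = 0 \<or> b = 0))"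

definition divides_in :: "'a::comm_ring_1 set \<Rightarrow> 'a \<Rightarrow> 'a \<Rightarrow> bool" where
  "divides_in S a b \<longleftrightarrow> (\<exists>c\<in>S. b = a * c)"

definition unit_in :: "'a::comm_ring_1 set \<Rightarrow> 'a \<Rightarrow> bool" where
  "unit_in S u \<longleftrightarrow> u \<in> S \<and> divides_in S u 1"

definition prime_in :: "'a::comm_ring_1 set \<Rightarrow> 'a \<Rightarrow> bool" where
  "prime_in S p \<longleftrightarrow> p \<in> S \<and> p \<noteq> 0 \<and> \<not> unit_in S p \<and>
     (\<forall>a\<in>S. \<forall>b\<in>S. divides_in S p (a * b) \<longrightarrow> divides_in S p a \<or> divides_in S p b)"

text \<open>
  The index counts the prime factors; it is the part of the induction measure that accounts for
  the leading coefficient in the factorization of polynomials.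
\<close>

inductive prime_product :: "'a::comm_ring_1 set \<Rightarrow> nat \<Rightarrow> 'a \<Rightarrow> bool" for S where
  unit: "unit_in S u \<Longrightarrow> prime_product S 0 u"
| prime: "prime_in S p \<Longrightarrow> prime_product S n a \<Longrightarrow> prime_product S (Suc n) (p * a)"

definition factorial_in :: "'a::comm_ring_1 set \<Rightarrow> bool" where
  "factorial_in S \<longleftrightarrow> domain_in S \<and> (\<forall>a\<in>S. a \<noteq> 0 \<longrightarrow> (\<exists>n. prime_product S n a))"

lemma domain_inD:
  assumes "domain_in S"
  shows domain_in_1: "1 \<in> S" and domain_in_0: "0 \<in> S"
    and domain_in_diff: "\<And>a b. a \<in> S \<Longrightarrow> b \<in> S \<Longrightarrow> a - b \<in> S"
    and domain_in_add: "\<And>a b. a \<in> S \<Longrightarrow> b \<in> S \<Longrightarrow> a + b \<in> S"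
    and domain_in_mult: "\<And>a b. a \<in> S \<Longrightarrow> b \<in> S \<Longrightarrow> a * b \<in> S"
    and domain_in_no_zero_divisors: "\<And>a b. a \<in> S \<Longrightarrow> b \<in> S \<Longrightarrow> a * b = 0 \<Longrightarrow> a = 0 \<or> b = 0"
proof -
  show 1: "1 \<in> S" and d: "\<And>a b. a \<in> S \<Longrightarrow> b \<in> S \<Longrightarrow> a - b \<in> S"
    and "\<And>a b. a \<in> S \<Longrightarrow> b \<in> S \<Longrightarrow> a * b \<in> S"
    and "\<And>a b. a \<in> S \<Longrightarrow> b \<in> S \<Longrightarrow> a * b = 0 \<Longrightarrow> a = 0 \<or> b = 0"
    using assms unfolding domain_in_def by blast+
  show 0: "0 \<in> S" using d[OF 1 1] by simp
  show "a + b \<in> S" if "a \<in> S" "b \<in> S" for a b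
    using d[OF that(1) d[OF 0 that(2)]] by simp
qed

lemma domain_in_sum:
  assumes "domain_in S" "\<And>i. i \<in> I \<Longrightarrow> f i \<in> S"
  shows "sum f I \<in> S"
  using assms(2) by (induction I rule: infinite_finite_induct)
    (auto intro: domain_in_0[OF assms(1)] domain_in_add[OF assms(1)])

lemma domain_in_prod:
  assumes "domain_in S" "\<And>i. i \<in> I \<Longrightarrow> f i \<in> S"
  shows "prod f I \<in> S"
  using assms(2) by (induction I rule: infinite_finite_induct)
    (auto intro: domain_in_1[OF assms(1)] domain_in_mult[OF assms(1)])

lemma domain_in_power:
  assumes "domain_in S" "a \<in> S"
  shows "a ^ n \<in> S"
  using domain_in_prod[OF assms(1), of "{..<n}" "\<lambda>_. a"] assms(2) by simp

lemma domain_in_cancel: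
  assumes "domain_in S" "a \<in> S" "b \<in> S" "c \<in> S" "a \<noteq> 0" "a * b = a * c"
  shows "b = c"
  using domain_in_no_zero_divisors[OF assms(1,2) domain_in_diff[OF assms(1,3,4)]] assms(5,6)
  by (simp add: right_diff_distrib)

lemma prime_product_in:
  assumes "domain_in S" "prime_product S n a"
  shows "a \<in> S" and "a \<noteq> 0"
proof -
  have "a \<in> S \<and> a \<noteq> 0"
    using assms(2)
  proof induction
    case (unit u)
    then show ?case by (auto simp: unit_in_def divides_in_def)
  next
    case (prime p n a)
    then show ?case
      using domain_in_mult[OF assms(1)] domain_in_no_zero_divisors[OF assms(1)]
      by (auto simp: prime_in_def)
  qed
  then show "a \<in> S" and "a \<noteq> 0" by auto
qed

lemma unit_in_mult:
  assumes "domain_in S" "unit_in S u" "unit_in S v"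
  shows "unit_in S (u * v)"
proof -
  obtain u' v' where "u' \<in> S" "v' \<in> S" "1 = u * u'" "1 = v * v'"
    using assms(2,3) by (auto simp: unit_in_def divides_in_def)
  moreover have "1 = u * v * (u' * v')"
    using calculation by (metis mult.assoc mult.left_commute mult_1_right)
  ultimately show ?thesis
    using assms domain_in_mult[OF assms(1)] unfolding unit_in_def divides_in_def by blast
qed

lemma unit_in_factor:
  assumes "domain_in S" "a \<in> S" "b \<in> S" "unit_in S (a * b)"
  shows "unit_in S a"
proof -
  obtain c where "c \<in> S" "1 = a * b * c"
    using assms(4) by (auto simp: unit_in_def divides_in_def)
  then show ?thesis
    using assms(2,3) domain_in_mult[OF assms(1)]
    unfolding unit_in_def divides_in_def by (metis mult.assoc)
qed

lemma prime_product_unit_mult: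
  assumes "domain_in S" "prime_product S n a" "unit_in S u"
  shows "prime_product S n (u * a)"
  using assms(2)
proof induction
  case (unit v)
  then show ?case using unit_in_mult[OF assms(1,3)] prime_product.unit by blast
next
  case (prime p n a)
  then show ?case
    using prime_product.prime[of S p n "u * a"] by (simp add: mult.left_commute)
qed

lemma prime_product_mult:
  assumes "domain_in S" "prime_product S m a" "prime_product S n b"
  shows "prime_product S (m + n) (a * b)"
  using assms(2)
proof induction
  case (unit u)
  then show ?case using prime_product_unit_mult[OF assms(1,3)] by simp
next
  case (prime p k a)
  then show ?case using prime_product.prime[of S p "k + n" "a * b"] by (simp add: mult.assoc)
qed

text \<open>
  A product of primes is primal: if it divides \<open>f * g\<close>, each of its prime factors can be taken out
  of \<open>f\<close> or of \<open>g\<close>, so it splits into a divisor of \<open>f\<close> and a divisor of \<open>g\<close>. With a constant for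
  \<open>q\<close> this cancels constants in the proof of Gauss's lemma.
\<close>

lemma prime_product_divides_mult:
  assumes "domain_in S" "prime_product S n q"
    and "f \<in> S" "g \<in> S" "h \<in> S" "q * h = f * g"
  shows "\<exists>q1\<in>S. \<exists>q2\<in>S. \<exists>f'\<in>S. \<exists>g'\<in>S. q = q1 * q2 \<and> f = q1 * f' \<and> g = q2 * g' \<and> h = f' * g'"
  using assms(2-)
proof (induction arbitrary: f g h)
  case (unit u)
  obtain v where v: "v \<in> S" "1 = u * v"
    using unit(1) by (auto simp: unit_in_def divides_in_def)
  have "h = f * (v * g)"
    using unit(5) v(2) by (metis mult.assoc mult.commute mult_1_left)
  moreover have "g = u * (v * g)"
    using v(2) by (metis mult.assoc mult_1_left)
  moreover have "u \<in> S" using unit(1) by (simp add: unit_in_def)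
  ultimately show ?case
    using unit(2,3) v(1) domain_in_1[OF assms(1)] domain_in_mult[OF assms(1)]
    by (metis mult_1_left)
next
  case (prime p n a)
  have p: "p \<in> S" "p \<noteq> 0" using prime(1) by (auto simp: prime_in_def)
  have a: "a \<in> S" using prime_product_in[OF assms(1) prime(2)] by simp
  note mult = domain_in_mult[OF assms(1)]
  have "divides_in S p (f * g)"
    unfolding divides_in_def using prime.prems(4) a prime.prems(3) mult
    by (metis mult.assoc)
  then consider "divides_in S p f" | "divides_in S p g"
    using prime(1) prime.prems(1,2) unfolding prime_in_def by blast
  then show ?case
  proof cases
    case 1
    then obtain f1 where f1: "f1 \<in> S" "f = p * f1" by (auto simp: divides_in_def)
    have "p * (a * h) = p * (f1 * g)" using prime.prems(4) f1(2) by (simp add: mult.assoc)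
    then have "a * h = f1 * g"
      by (rule domain_in_cancel[OF assms(1) p(1) mult[OF a prime.prems(3)]
            mult[OF f1(1) prime.prems(2)] p(2)])
    from prime.IH[OF f1(1) prime.prems(2,3) this] obtain q1 q2 f' g' where IH:
      "q1 \<in> S" "q2 \<in> S" "f' \<in> S" "g' \<in> S" "a = q1 * q2" "f1 = q1 * f'" "g = q2 * g'" "h = f' * g'"
      by blast
    then have "p * a = (p * q1) * q2" "f = (p * q1) * f'"
      using f1(2) by (simp_all add: mult.assoc)
    then show ?thesis using IH mult[OF p(1) IH(1)] by blast
  next
    case 2
    then obtain g1 where g1: "g1 \<in> S" "g = p * g1" by (auto simp: divides_in_def)
    have "p * (a * h) = p * (f * g1)" using prime.prems(4) g1(2) by (simp add: ac_simps)
    then have "a * h = f * g1"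
      by (rule domain_in_cancel[OF assms(1) p(1) mult[OF a prime.prems(3)]
            mult[OF prime.prems(1) g1(1)] p(2)])
    from prime.IH[OF prime.prems(1) g1(1) prime.prems(3) this] obtain q1 q2 f' g' where IH:
      "q1 \<in> S" "q2 \<in> S" "f' \<in> S" "g' \<in> S" "a = q1 * q2" "f = q1 * f'" "g1 = q2 * g'" "h = f' * g'"
      by blast
    then have "p * a = q1 * (p * q2)" "g = (p * q2) * g'"
      using g1(2) by (simp_all add: ac_simps)
    then show ?thesis using IH mult[OF p(1) IH(2)] by blast
  qed
qed

lemma prime_product_factor:
  assumes "domain_in S" "prime_product S n c" "a \<in> S" "b \<in> S" "c = a * b"
  shows "\<exists>i j. prime_product S i a \<and> prime_product S j b \<and> i + j = n"
  using assms(2-)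
proof (induction arbitrary: a b)
  case (unit u)
  then show ?case
    using unit_in_factor[OF assms(1)] prime_product.unit by (metis add_0 mult.commute)
next
  case (prime p n c)
  have p: "p \<in> S" "p \<noteq> 0" using prime(1) by (auto simp: prime_in_def)
  have c: "c \<in> S" using prime_product_in[OF assms(1) prime(2)] by simp
  note mult = domain_in_mult[OF assms(1)]
  have "divides_in S p (a * b)"
    unfolding divides_in_def using prime.prems(3) c by metis
  then consider "divides_in S p a" | "divides_in S p b"
    using prime(1) prime.prems(1,2) unfolding prime_in_def by blast
  then show ?case
  proof cases
    case 1
    then obtain a1 where a1: "a1 \<in> S" "a = p * a1" by (auto simp: divides_in_def)
    have "p * c = p * (a1 * b)" using prime.prems(3) a1(2) by (simp add: mult.assoc)
    then have "c = a1 * b"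
      by (rule domain_in_cancel[OF assms(1) p(1) c mult[OF a1(1) prime.prems(2)] p(2)])
    from prime.IH[OF a1(1) prime.prems(2) this] obtain i j where
      "prime_product S i a1" "prime_product S j b" "i + j = n" by blast
    then show ?thesis
      using a1(2) prime_product.prime[OF prime(1)] by (intro exI[of _ "Suc i"] exI[of _ j]) auto
  next
    case 2
    then obtain b1 where b1: "b1 \<in> S" "b = p * b1" by (auto simp: divides_in_def)
    have "p * c = p * (a * b1)" using prime.prems(3) b1(2) by (simp add: ac_simps)
    then have "c = a * b1"
      by (rule domain_in_cancel[OF assms(1) p(1) c mult[OF prime.prems(1) b1(1)] p(2)])
    from prime.IH[OF prime.prems(1) b1(1) this] obtain i j where
      "prime_product S i a" "prime_product S j b1" "i + j = n" by blast
    then show ?thesis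
      using b1(2) prime_product.prime[OF prime(1)] by (intro exI[of _ i] exI[of _ "Suc j"]) auto
  qed
qed

text \<open>
  Transport along a ring isomorphism; below it is the evaluation that identifies \<open>S[X]\<close> with the
  ring generated by \<open>S\<close> and one more variable.
\<close>

lemma prime_product_image:
  assumes "domain_in R" and inj: "inj_on \<phi> R" and "\<phi> 1 = 1"
    and hom: "\<And>a b. \<phi> (a * b) = \<phi> a * \<phi> b" and "\<phi> 0 = 0"
    and "prime_product R n a"
  shows "prime_product (\<phi> ` R) n (\<phi> a)"
proof -
  note mult = domain_in_mult[OF assms(1)]
  have dvd: "divides_in (\<phi> ` R) (\<phi> a) (\<phi> b) \<longleftrightarrow> divides_in R a b" if "a \<in> R" "b \<in> R" for a b
    unfolding divides_in_def using that inj mult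
    by (auto simp: hom[symmetric] inj_on_eq_iff[OF inj])
  have unit: "unit_in (\<phi> ` R) (\<phi> a) \<longleftrightarrow> unit_in R a" if "a \<in> R" for a
    unfolding unit_in_def using that dvd[of a 1] domain_in_1[OF assms(1)] \<open>\<phi> 1 = 1\<close> by auto
  have prime: "prime_in (\<phi> ` R) (\<phi> p)" if "prime_in R p" for p
  proof -
    have "p \<in> R" using that by (simp add: prime_in_def)
    moreover have "\<phi> p \<noteq> 0"
      using that inj_onD[OF inj, of p 0] domain_in_0[OF assms(1)] \<open>\<phi> 0 = 0\<close>
      by (auto simp: prime_in_def)
    ultimately show ?thesis
      using that unit dvd mult unfolding prime_in_def by (auto simp: hom[symmetric])
  qed
  show ?thesis
    using assms(6)
  proof induction
    case (unit u)
    then show ?case using \<open>\<And>a. a \<in> R \<Longrightarrow> unit_in (\<phi> ` R) (\<phi> a) \<longleftrightarrow> unit_in R a\<close>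
      by (intro prime_product.unit) (auto simp: unit_in_def)
  next
    case (prime p n a)
    then show ?case
      using \<open>\<And>p. prime_in R p \<Longrightarrow> prime_in (\<phi> ` R) (\<phi> p)\<close> prime_product.prime[of "\<phi> ` R"]
      by (simp add: hom)
  qed
qed

lemma factorial_in_image:
  assumes "factorial_in R" and inj: "inj_on \<phi> R" and one: "\<phi> 1 = 1"
    and mult: "\<And>a b. \<phi> (a * b) = \<phi> a * \<phi> b" and diff: "\<And>a b. \<phi> (a - b) = \<phi> a - \<phi> b"
  shows "factorial_in (\<phi> ` R)"
proof -
  have dom: "domain_in R" using assms(1) by (simp add: factorial_in_def)
  have zero: "\<phi> 0 = 0" using diff[of 0 0] by simp
  have ker: "\<phi> a = 0 \<longleftrightarrow> a = 0" if "a \<in> R" for a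
    using inj_on_eq_iff[OF inj that domain_in_0[OF dom]] zero by simp
  have "domain_in (\<phi> ` R)"
    unfolding domain_in_def
  proof (intro conjI ballI impI)
    show "1 \<in> \<phi> ` R" using one domain_in_1[OF dom] by (metis imageI)
    fix a b assume "a \<in> \<phi> ` R" "b \<in> \<phi> ` R"
    then obtain a' b' where ab: "a' \<in> R" "b' \<in> R" "a = \<phi> a'" "b = \<phi> b'" by blast
    show "a - b \<in> \<phi> ` R" "a * b \<in> \<phi> ` R"
      using ab domain_in_diff[OF dom] domain_in_mult[OF dom]
      by (auto simp: mult[symmetric] diff[symmetric])
    assume "a * b = 0"
    then have "a' * b' = 0" using ab ker domain_in_mult[OF dom] by (simp add: mult[symmetric])
    then show "a = 0 \<or> b = 0" using domain_in_no_zero_divisors[OF dom ab(1,2)] ab zero by auto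
  qed
  moreover have "\<exists>n. prime_product (\<phi> ` R) n a" if a: "a \<in> \<phi> ` R" "a \<noteq> 0" for a
  proof -
    obtain a' where "a' \<in> R" "a = \<phi> a'" "a' \<noteq> 0" using a zero by auto
    then show ?thesis
      using prime_product_image[OF dom inj one mult zero] assms(1)
      unfolding factorial_in_def by blast
  qed
  ultimately show ?thesis by (simp add: factorial_in_def)
qed

section \<open>Gauss's lemma\<close>

text \<open>
  This is \<open>S[X]\<close>, as a subset of the polynomials over the ambient ring.
\<close>

definition polys_over :: "'a::comm_ring_1 set \<Rightarrow> 'a poly set" where
  "polys_over S = {f. \<forall>i. coeff f i \<in> S}"

context
  fixes S :: "'a::comm_ring_1 set"
  assumes dom: "domain_in S"
begin

lemma polys_over_mult: "f \<in> polys_over S \<Longrightarrow> g \<in> polys_over S \<Longrightarrow> f * g \<in> polys_over S"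
  by (auto simp: polys_over_def coeff_mult intro!: domain_in_sum[OF dom] domain_in_mult[OF dom])

lemma polys_over_diff: "f \<in> polys_over S \<Longrightarrow> g \<in> polys_over S \<Longrightarrow> f - g \<in> polys_over S"
  by (auto simp: polys_over_def intro!: domain_in_diff[OF dom])

lemma polys_over_const: "[:c:] \<in> polys_over S \<longleftrightarrow> c \<in> S"
  using domain_in_0[OF dom] by (auto simp: polys_over_def coeff_pCons split: nat.split)

lemma polys_over_monom: "c \<in> S \<Longrightarrow> monom c n \<in> polys_over S"
  using domain_in_0[OF dom] by (auto simp: polys_over_def)

lemma polys_over_pCons: "pCons c f \<in> polys_over S \<longleftrightarrow> c \<in> S \<and> f \<in> polys_over S"
  by (auto simp: polys_over_def coeff_pCons split: nat.splits)

lemma polys_over_lead_coeff_mult_nonzero: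
  assumes "f \<in> polys_over S" "g \<in> polys_over S" "f \<noteq> 0" "g \<noteq> 0"
  shows "lead_coeff f * lead_coeff g \<noteq> 0"
  using assms domain_in_no_zero_divisors[OF dom, of "lead_coeff f" "lead_coeff g"]
  by (auto simp: polys_over_def)

lemma polys_over_degree_mult:
  assumes "f \<in> polys_over S" "g \<in> polys_over S" "f \<noteq> 0" "g \<noteq> 0"
  shows "degree (f * g) = degree f + degree g"
    and "lead_coeff (f * g) = lead_coeff f * lead_coeff g"
proof -
  show "degree (f * g) = degree f + degree g"
    using polys_over_lead_coeff_mult_nonzero[OF assms] degree_mult_le[of f g]
    by (metis coeff_mult_degree_sum le_antisym le_degree)
  then show "lead_coeff (f * g) = lead_coeff f * lead_coeff g"
    by (simp add: coeff_mult_degree_sum)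
qed

lemma domain_in_polys_over: "domain_in (polys_over S)"
  unfolding domain_in_def
proof (intro conjI ballI impI)
  show "1 \<in> polys_over S" using polys_over_const domain_in_1[OF dom] by (simp add: one_pCons)
  fix f g assume fg: "f \<in> polys_over S" "g \<in> polys_over S"
  then show "f - g \<in> polys_over S" "f * g \<in> polys_over S"
    by (auto intro: polys_over_diff polys_over_mult)
  show "f = 0 \<or> g = 0" if "f * g = 0"
    using polys_over_lead_coeff_mult_nonzero[OF fg] polys_over_degree_mult[OF fg] that
    by (metis leading_coeff_0_iff)
qed

lemma const_divides_in_pCons:
  assumes "c \<in> S"
  shows "divides_in (polys_over S) [:c:] (pCons a f) \<longleftrightarrow>
    divides_in S c a \<and> divides_in (polys_over S) [:c:] f"
proof
  assume "divides_in (polys_over S) [:c:] (pCons a f)"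
  then obtain h where h: "h \<in> polys_over S" "pCons a f = [:c:] * h" by (auto simp: divides_in_def)
  obtain b k where "h = pCons b k" by (cases h)
  then show "divides_in S c a \<and> divides_in (polys_over S) [:c:] f"
    using h polys_over_pCons[of b k] by (auto simp: divides_in_def mult.commute)
next
  assume "divides_in S c a \<and> divides_in (polys_over S) [:c:] f"
  then obtain b k where "b \<in> S" "k \<in> polys_over S" "a = c * b" "f = [:c:] * k"
    by (auto simp: divides_in_def)
  then show "divides_in (polys_over S) [:c:] (pCons a f)"
    unfolding divides_in_def using polys_over_pCons by (intro bexI[of _ "pCons b k"]) auto
qed

lemma divides_in_add_iff:
  assumes "domain_in R" "divides_in R p a"
  shows "divides_in R p (a + b) \<longleftrightarrow> divides_in R p b"
proof -
  obtain c where c: "c \<in> R" "a = p * c" using assms(2) by (auto simp: divides_in_def)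
  show ?thesis
  proof
    assume "divides_in R p (a + b)"
    then obtain d where "d \<in> R" "a + b = p * d" by (auto simp: divides_in_def)
    then have "b = p * (d - c)" using c by (simp add: algebra_simps)
    then show "divides_in R p b"
      using \<open>d \<in> R\<close> c domain_in_diff[OF assms(1)] by (auto simp: divides_in_def)
  next
    assume "divides_in R p b"
    then show "divides_in R p (a + b)"
      using c domain_in_add[OF assms(1)] by (auto simp: divides_in_def distrib_left[symmetric])
  qed
qed

lemma divides_in_mult_left:
  assumes "domain_in R" "divides_in R p a" "b \<in> R"
  shows "divides_in R p (a * b)"
  using assms domain_in_mult[OF assms(1)] unfolding divides_in_def by (metis mult.assoc)

text \<open>
  The content half of Gauss's lemma: \<open>S[X]\<close> modulo \<open>p\<close> has no zero divisors. If \<open>p\<close> divides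
  \<open>f * g\<close>, it divides the product of the two constant terms and hence one of them; that constant
  term can be dropped, and the induction proceeds on the remaining coefficients.
\<close>

lemma prime_in_const:
  assumes "prime_in S p"
  shows "prime_in (polys_over S) [:p:]"
proof -
  note domP = domain_in_polys_over
  have p: "p \<in> S" "p \<noteq> 0" "\<not> unit_in S p" using assms by (auto simp: prime_in_def)
  have div0: "divides_in (polys_over S) [:p:] 0"
    using domain_in_0[OF domP] unfolding divides_in_def by (metis mult_zero_right)
  have "divides_in (polys_over S) [:p:] f \<or> divides_in (polys_over S) [:p:] g"
    if "f \<in> polys_over S" "g \<in> polys_over S" "divides_in (polys_over S) [:p:] (f * g)" for f g
    using that
  proof (induction "length (coeffs f) + length (coeffs g)" arbitrary: f g rule: less_induct)
    case less
    show ?case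
    proof (cases "f = 0 \<or> g = 0")
      case True
      then show ?thesis using div0 by auto
    next
      case False
      obtain a f' where f: "f = pCons a f'" by (cases f)
      obtain b g' where g: "g = pCons b g'" by (cases g)
      have in_S: "a \<in> S" "f' \<in> polys_over S" "b \<in> S" "g' \<in> polys_over S"
        using less.prems f g polys_over_pCons by auto
      have len: "length (coeffs f) = Suc (length (coeffs f'))"
                "length (coeffs g) = Suc (length (coeffs g'))"
        using False f g by (auto simp: cCons_def)
      have "f * g = pCons (a * b) (Polynomial.smult a g' + f' * g)"
        unfolding f g by simp
      then have "divides_in S p (a * b)"
        using less.prems(3) const_divides_in_pCons[OF p(1)] by simp
      then consider "divides_in S p a" | "divides_in S p b"
        using assms in_S unfolding prime_in_def by blast
      then show ?thesis
      proof cases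
        case 1
        then have "divides_in (polys_over S) [:p:] [:a:]"
          using const_divides_in_pCons[OF p(1)] div0 by simp
        then have "divides_in (polys_over S) [:p:] ([:a:] * g)"
          using divides_in_mult_left[OF domP] less.prems by blast
        moreover have "f * g = [:a:] * g + pCons 0 (f' * g)" unfolding f by simp
        ultimately have "divides_in (polys_over S) [:p:] (f' * g)"
          using less.prems(3) divides_in_add_iff[OF domP] const_divides_in_pCons[OF p(1)] by metis
        then show ?thesis
          using less.hyps[of f' g] len in_S less.prems 1 const_divides_in_pCons[OF p(1)]
          unfolding f by auto
      next
        case 2
        then have "divides_in (polys_over S) [:p:] [:b:]"
          using const_divides_in_pCons[OF p(1)] div0 by simp
        then have "divides_in (polys_over S) [:p:] ([:b:] * f)"
          using divides_in_mult_left[OF domP] less.prems by blast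
        moreover have "f * g = [:b:] * f + pCons 0 (f * g')" unfolding g by simp
        ultimately have "divides_in (polys_over S) [:p:] (f * g')"
          using less.prems(3) divides_in_add_iff[OF domP] const_divides_in_pCons[OF p(1)] by metis
        then show ?thesis
          using less.hyps[of f g'] len in_S less.prems 2 const_divides_in_pCons[OF p(1)]
          unfolding g by auto
      qed
    qed
  qed
  moreover have "\<not> unit_in (polys_over S) [:p:]"
    using p const_divides_in_pCons[OF p(1), of 1 0] by (auto simp: unit_in_def one_pCons)
  ultimately show ?thesis
    using p polys_over_const by (auto simp: prime_in_def)
qed

lemma unit_in_const: "unit_in S u \<Longrightarrow> unit_in (polys_over S) [:u:]"
  using const_divides_in_pCons[of u 1 0] polys_over_const domain_in_0[OF domain_in_polys_over]
  unfolding unit_in_def one_pCons divides_in_def by (metis mult_zero_right)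

lemma prime_product_const:
  assumes "prime_product S n c"
  shows "prime_product (polys_over S) n [:c:]"
  using assms
proof induction
  case (unit u)
  then show ?case by (intro prime_product.unit unit_in_const)
next
  case (prime p n a)
  then show ?case using prime_product.prime[OF prime_in_const] by fastforce
qed

text \<open>
  Division with remainder works over a ring once the dividend is multiplied by a nonzero constant,
  namely a power of the leading coefficient of the divisor.
\<close>

lemma pseudo_division:
  assumes "d \<in> polys_over S" "d \<noteq> 0" "h \<in> polys_over S"
  shows "\<exists>c\<in>S. \<exists>a\<in>polys_over S. \<exists>r\<in>polys_over S. c \<noteq> 0 \<and>
    [:c:] * h = a * d + r \<and> (r = 0 \<or> degree r < degree d)"
  using assms(3)
proof (induction "degree h" arbitrary: h rule: less_induct)
  case less
  note domP = domain_in_polys_over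
  show ?case
  proof (cases "h = 0 \<or> degree h < degree d")
    case True
    then show ?thesis
      using less.prems domain_in_1[OF dom] domain_in_0[OF domP]
      by (intro bexI[of _ 1] bexI[of _ 0] bexI[of _ h]) (auto simp: one_pCons[symmetric])
  next
    case False
    define a where "a = monom (lead_coeff h) (degree h - degree d)"
    \<comment> \<open>The leading terms cancel in \<open>h'\<close>, which makes the induction on the degree work.\<close>
    define h' where "h' = [:lead_coeff d:] * h - a * d"
    have lc: "lead_coeff d \<in> S" "lead_coeff d \<noteq> 0" "lead_coeff h \<in> S"
      using assms less.prems by (auto simp: polys_over_def)
    have a: "a \<in> polys_over S" unfolding a_def by (rule polys_over_monom[OF lc(3)])
    have h': "h' \<in> polys_over S"
      unfolding h'_def using a lc assms less.prems polys_over_const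
      by (intro polys_over_diff polys_over_mult) auto
    have "degree (a * d) \<le> degree h"
      using False degree_mult_le[of a d] degree_monom_le[of "lead_coeff h" "degree h - degree d"]
      unfolding a_def by linarith
    then have deg: "degree h' \<le> degree h"
      unfolding h'_def by (intro degree_diff_le) (simp_all add: degree_smult_le)
    have "coeff (a * d) (degree h) = lead_coeff h * lead_coeff d"
      unfolding a_def using False by (simp add: coeff_monom_mult)
    then have coeff0: "coeff h' (degree h) = 0"
      unfolding h'_def by simp
    have "\<exists>c\<in>S. \<exists>b\<in>polys_over S. \<exists>r\<in>polys_over S. c \<noteq> 0 \<and>
        [:c:] * h' = b * d + r \<and> (r = 0 \<or> degree r < degree d)"
    proof (cases "h' = 0")
      case True
      then show ?thesis
        using domain_in_1[OF dom] domain_in_0[OF domP]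
        by (intro bexI[of _ 1] bexI[of _ 0] bexI[of _ 0]) auto
    next
      case False
      then have "degree h' < degree h"
        using deg coeff0 by (metis le_neq_implies_less leading_coeff_0_iff)
      then show ?thesis using less.hyps h' by blast
    qed
    then obtain c b r where c: "c \<in> S" "b \<in> polys_over S" "r \<in> polys_over S" "c \<noteq> 0"
      "[:c:] * h' = b * d + r" "r = 0 \<or> degree r < degree d" by blast
    have "[:c * lead_coeff d:] * h = [:c:] * ([:lead_coeff d:] * h)" by (simp add: mult.commute)
    also have "\<dots> = [:c:] * (h' + a * d)" unfolding h'_def by simp
    also have "\<dots> = (b + [:c:] * a) * d + r" using c(5) by (simp add: algebra_simps)
    finally have "[:c * lead_coeff d:] * h = (b + [:c:] * a) * d + r" .
    moreover have "c * lead_coeff d \<noteq> 0"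
      using c lc domain_in_no_zero_divisors[OF dom] by blast
    moreover have "c * lead_coeff d \<in> S" using c lc domain_in_mult[OF dom] by blast
    moreover have "b + [:c:] * a \<in> polys_over S"
      using c a polys_over_const domain_in_add[OF domP] domain_in_mult[OF domP] by blast
    ultimately show ?thesis using c(3,6) by blast
  qed
qed

end

context
  fixes S :: "'a::comm_ring_1 set"
  assumes fac: "factorial_in S"
begin

lemma factorial_in_domain: "domain_in S"
  using fac by (simp add: factorial_in_def)

lemmas domain_polys = domain_in_polys_over[OF factorial_in_domain]

lemma unit_in_polys_over_degree:
  assumes "unit_in (polys_over S) f"
  shows "degree f = 0"
proof -
  obtain g where g: "f \<in> polys_over S" "g \<in> polys_over S" "1 = f * g"
    using assms by (auto simp: unit_in_def divides_in_def)
  then have "f \<noteq> 0" "g \<noteq> 0" by auto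
  then have "degree (1 :: 'a poly) = degree f + degree g"
    using polys_over_degree_mult(1)[OF factorial_in_domain g(1,2)] g(3) by simp
  then show ?thesis by simp
qed

text \<open>
  Nonzero constants can be cancelled from divisibility by an irreducible \<open>q\<close> of positive degree:
  the constant is a product of primes, each of which divides \<open>q\<close> or the cofactor \<open>w\<close>, and the part
  that divides \<open>q\<close> is a unit by irreducibility. This replaces the passage to the fraction field.
\<close>

lemma irreducible_divides_in_const_mult:
  assumes irred: "\<And>a b. a \<in> polys_over S \<Longrightarrow> b \<in> polys_over S \<Longrightarrow> q = a * b \<Longrightarrow>
      unit_in (polys_over S) a \<or> unit_in (polys_over S) b"
    and q: "q \<in> polys_over S" "0 < degree q"
    and "c \<in> S" "c \<noteq> 0" "f \<in> polys_over S" "w \<in> polys_over S" "[:c:] * f = q * w"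
  shows "divides_in (polys_over S) q f"
proof -
  obtain n where "prime_product S n c" using fac assms by (auto simp: factorial_in_def)
  then have "prime_product (polys_over S) n [:c:]"
    by (rule prime_product_const[OF factorial_in_domain])
  from prime_product_divides_mult[OF domain_polys this q(1) assms(7,6,8)]
  obtain y1 y2 q' w' where y: "y1 \<in> polys_over S" "y2 \<in> polys_over S" "q' \<in> polys_over S"
      "w' \<in> polys_over S" "[:c:] = y1 * y2" "q = y1 * q'" "f = q' * w'"
    by blast
  have nz: "y1 \<noteq> 0" "y2 \<noteq> 0" "q' \<noteq> 0" using y \<open>c \<noteq> 0\<close> q by auto
  have "degree y1 = 0"
    using polys_over_degree_mult(1)[OF factorial_in_domain y(1,2) nz(1,2)] y(5)
    by (metis add_is_0 degree_pCons_0)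
  then have degq': "degree q' > 0"
    using polys_over_degree_mult(1)[OF factorial_in_domain y(1,3) nz(1,3)] y(6) q by simp
  have "\<not> unit_in (polys_over S) q'" using degq' unit_in_polys_over_degree by fastforce
  then have "unit_in (polys_over S) y1" using irred[OF y(1,3,6)] by blast
  then obtain v where v: "v \<in> polys_over S" "1 = y1 * v" by (auto simp: unit_in_def divides_in_def)
  have "q * (v * w') = (y1 * v) * (q' * w')" using y(6) by (simp add: ac_simps)
  also have "\<dots> = f" using v(2) y(7) by simp
  finally show ?thesis
    using v(1) y(4) domain_in_mult[OF domain_polys] unfolding divides_in_def by metis
qed

text \<open>
  Take a nonzero element \<open>d\<close> of least degree in the ideal generated by \<open>q\<close> and \<open>f\<close>. By
  pseudo-division it divides constant multiples of \<open>q\<close> and of \<open>f\<close>. Up to constants, irreducibility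
  makes \<open>d\<close> either an associate of \<open>q\<close>, so that \<open>q\<close> divides a constant multiple of \<open>f\<close>, or a
  constant, so that a constant multiple of \<open>g\<close> lies in the ideal generated by \<open>q\<close> and \<open>f * g\<close>,
  which consists of multiples of \<open>q\<close>. The constants are then cancelled.
\<close>

lemma irreducible_prime_in_polys_over:
  assumes irred: "\<And>a b. a \<in> polys_over S \<Longrightarrow> b \<in> polys_over S \<Longrightarrow> q = a * b \<Longrightarrow>
      unit_in (polys_over S) a \<or> unit_in (polys_over S) b"
    and q: "q \<in> polys_over S" "0 < degree q"
  shows "prime_in (polys_over S) q"
proof -
  note mult = domain_in_mult[OF domain_polys]
  have cancel_const: "divides_in (polys_over S) q f"
    if "c \<in> S" "c \<noteq> 0" "f \<in> polys_over S" "w \<in> polys_over S" "[:c:] * f = q * w" for c f w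
    by (rule irreducible_divides_in_const_mult[OF _ q that]) (fact irred)
  have "q \<noteq> 0" using q by auto
  have "\<not> unit_in (polys_over S) q" using q(2) unit_in_polys_over_degree by fastforce
  moreover have "divides_in (polys_over S) q f \<or> divides_in (polys_over S) q g"
    if fg: "f \<in> polys_over S" "g \<in> polys_over S" "divides_in (polys_over S) q (f * g)" for f g
  proof -
    \<comment> \<open>The ideal of \<open>S[X]\<close> generated by \<open>q\<close> and \<open>f\<close>.\<close>
    define J where "J = {u * q + v * f |u v. u \<in> polys_over S \<and> v \<in> polys_over S}"
    have "q \<in> J" unfolding J_def
      using domain_in_1[OF domain_polys] domain_in_0[OF domain_polys]
      by (intro CollectI exI[of _ 1] exI[of _ 0]) auto
    have "f \<in> J" unfolding J_def
      using domain_in_1[OF domain_polys] domain_in_0[OF domain_polys]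
      by (intro CollectI exI[of _ 0] exI[of _ 1]) auto
    have "\<exists>d. d \<in> J \<and> d \<noteq> 0 \<and> (\<forall>e. e \<in> J \<and> e \<noteq> 0 \<longrightarrow> degree d \<le> degree e)"
      using ex_has_least_nat[of "\<lambda>d. d \<in> J \<and> d \<noteq> 0" q degree] \<open>q \<in> J\<close> \<open>q \<noteq> 0\<close> by auto
    then obtain d where d: "d \<in> J" "d \<noteq> 0"
      "\<And>e. e \<in> J \<Longrightarrow> e \<noteq> 0 \<Longrightarrow> degree d \<le> degree e" by blast
    then obtain u v where uv: "u \<in> polys_over S" "v \<in> polys_over S" "d = u * q + v * f"
      by (auto simp: J_def)
    have JP: "J \<subseteq> polys_over S"
      using q fg mult domain_in_add[OF domain_polys] by (auto simp: J_def)
    have multiple: "\<exists>c\<in>S. \<exists>a\<in>polys_over S. c \<noteq> 0 \<and> [:c:] * h = a * d" if "h \<in> J" for h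
    proof -
      have "d \<in> polys_over S" "h \<in> polys_over S" using JP d(1) that by auto
      from pseudo_division[OF factorial_in_domain this(1) d(2) this(2)]
      obtain c a r where c: "c \<in> S" "a \<in> polys_over S" "r \<in> polys_over S" "c \<noteq> 0"
        "[:c:] * h = a * d + r" "r = 0 \<or> degree r < degree d"
        by blast
      obtain u' v' where uv': "u' \<in> polys_over S" "v' \<in> polys_over S" "h = u' * q + v' * f"
        using \<open>h \<in> J\<close> by (auto simp: J_def)
      have "r = [:c:] * h - a * d" using c(5) by simp
      also have "\<dots> = ([:c:] * u' - a * u) * q + ([:c:] * v' - a * v) * f"
        unfolding uv(3) uv'(3) by (simp only: algebra_simps)
      finally have "r \<in> J"
        unfolding J_def using uv uv' c polys_over_const[OF factorial_in_domain]
        by (blast intro: mult domain_in_diff[OF domain_polys])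
      then have "r = 0" using d(3) c(6) by fastforce
      then show ?thesis using c by auto
    qed
    from multiple[OF \<open>q \<in> J\<close>] obtain c1 a1 where
      c1: "c1 \<in> S" "a1 \<in> polys_over S" "c1 \<noteq> 0" "[:c1:] * q = a1 * d" by blast
    from multiple[OF \<open>f \<in> J\<close>] obtain c2 a2 where
      c2: "c2 \<in> S" "a2 \<in> polys_over S" "c2 \<noteq> 0" "[:c2:] * f = a2 * d" by blast
    obtain n where "prime_product S n c1" using fac c1 by (auto simp: factorial_in_def)
    then have "prime_product (polys_over S) n [:c1:]"
      by (rule prime_product_const[OF factorial_in_domain])
    from prime_product_divides_mult[OF domain_polys this c1(2) _ q(1) c1(4)] d(1) JP
    obtain x1 x2 a' d' where x: "x1 \<in> polys_over S" "x2 \<in> polys_over S" "a' \<in> polys_over S"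
      "d' \<in> polys_over S" "[:c1:] = x1 * x2" "a1 = x1 * a'" "d = x2 * d'" "q = a' * d'" by blast
    \<comment> \<open>The factors \<open>x1\<close> and \<open>x2\<close> divide the constant \<open>c1\<close>, so \<open>d\<close> agrees with \<open>d'\<close> up to a constant.\<close>
    from irred[OF x(3,4,8)] show ?thesis
    proof
      assume "unit_in (polys_over S) a'"
      then obtain e where e: "e \<in> polys_over S" "1 = a' * e"
        by (auto simp: unit_in_def divides_in_def)
      have "q * (a2 * x2 * e) = (a' * e) * (a2 * (x2 * d'))" unfolding x(8) by (simp only: ac_simps)
      also have "\<dots> = [:c2:] * f" using e(2) c2(4) x(7) by simp
      finally have "divides_in (polys_over S) q f"
        by (intro cancel_const[OF c2(1,3) fg(1) mult[OF mult[OF c2(2) x(2)] e(1)]]) (rule sym)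
      then show ?thesis ..
    next
      assume "unit_in (polys_over S) d'"
      then obtain e where e: "e \<in> polys_over S" "1 = d' * e"
        by (auto simp: unit_in_def divides_in_def)
      obtain w where w: "w \<in> polys_over S" "f * g = q * w" using fg by (auto simp: divides_in_def)
      have "[:c1:] * g = x1 * e * (d * g)"
        using e(2) unfolding x(5,7) by (metis (no_types, lifting) mult.assoc mult.commute mult_1_right)
      also have "d * g = q * (u * g) + v * (f * g)"
        unfolding uv(3) by (simp only: algebra_simps)
      also have "x1 * e * \<dots> = q * (x1 * e * (u * g + v * w))"
        unfolding w(2) by (simp only: algebra_simps)
      finally have eq: "[:c1:] * g = q * (x1 * e * (u * g + v * w))" .
      have "x1 * e * (u * g + v * w) \<in> polys_over S"
        by (intro mult domain_in_add[OF domain_polys] uv x e fg w)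
      then have "divides_in (polys_over S) q g"
        by (rule cancel_const[OF c1(1,3) fg(2) _ eq])
      then show ?thesis ..
    qed
  qed
  ultimately show ?thesis using q(1) \<open>q \<noteq> 0\<close> by (auto simp: prime_in_def)
qed

text \<open>
  A proper factorization decreases the degree plus the number of primes in the leading coefficient,
  because a factor for which this sum is zero is a unit. Splitting therefore ends, and it ends in
  constants and irreducibles, both of which have been treated.
\<close>

lemma factorial_in_polys_over: "factorial_in (polys_over S)"
proof -
  have "\<exists>k. prime_product (polys_over S) k f"
    if "f \<in> polys_over S" "f \<noteq> 0" "prime_product S n (lead_coeff f)" for f n
    using that
  proof (induction "degree f + n" arbitrary: f n rule: less_induct)
    case less
    show ?case
    proof (cases "degree f = 0")
      case True
      then obtain c where "f = [:c:]" by (rule degree_eq_zeroE)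
      then show ?thesis
        using prime_product_const[OF factorial_in_domain] less.prems by auto
    next
      case False
      show ?thesis
      proof (cases "\<forall>a\<in>polys_over S. \<forall>b\<in>polys_over S. f = a * b \<longrightarrow>
          unit_in (polys_over S) a \<or> unit_in (polys_over S) b")
        case True
        then have "prime_in (polys_over S) f"
          using irreducible_prime_in_polys_over less.prems False by blast
        moreover have "unit_in (polys_over S) 1"
          using domain_in_1[OF domain_polys] by (auto simp: unit_in_def divides_in_def)
        ultimately show ?thesis
          using prime_product.prime prime_product.unit by (metis mult_1_right)
      next
        case False
        then obtain a b where ab: "a \<in> polys_over S" "b \<in> polys_over S" "f = a * b"
          "\<not> unit_in (polys_over S) a" "\<not> unit_in (polys_over S) b" by blast
        have nz: "a \<noteq> 0" "b \<noteq> 0" using less.prems ab by auto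
        note deg = polys_over_degree_mult[OF factorial_in_domain ab(1,2) nz]
        obtain i j where ij: "prime_product S i (lead_coeff a)" "prime_product S j (lead_coeff b)"
          "i + j = n"
          using prime_product_factor[OF factorial_in_domain less.prems(3), of "lead_coeff a" "lead_coeff b"]
            ab deg by (auto simp: polys_over_def)
        have pos: "degree h + k > 0"
          if "h \<in> polys_over S" "\<not> unit_in (polys_over S) h" "prime_product S k (lead_coeff h)" for h k
        proof (rule ccontr)
          assume "\<not> degree h + k > 0"
          then have "degree h = 0" "k = 0" by auto
          obtain c where c: "h = [:c:]" using \<open>degree h = 0\<close> by (rule degree_eq_zeroE)
          then have "prime_product S 0 c" using that(3) \<open>k = 0\<close> by simp
          then have "unit_in S c" by cases
          then show False using that(2) unit_in_const[OF factorial_in_domain] c by simp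
        qed
        have "\<exists>k. prime_product (polys_over S) k a" "\<exists>k. prime_product (polys_over S) k b"
          using less.hyps[OF _ ab(1) nz(1) ij(1)] less.hyps[OF _ ab(2) nz(2) ij(2)]
            pos[OF ab(1,4) ij(1)] pos[OF ab(2,5) ij(2)] deg(1) ij(3) ab(3) by auto
        then show ?thesis using prime_product_mult[OF domain_polys] ab(3) by blast
      qed
    qed
  qed
  moreover have "\<exists>n. prime_product S n (lead_coeff f)" if "f \<in> polys_over S" "f \<noteq> 0" for f
    using fac that by (auto simp: factorial_in_def polys_over_def)
  ultimately show ?thesis using domain_polys unfolding factorial_in_def by blast
qed

end

section \<open>Unique factorization of multivariate polynomials\<close>

lemma mpoly_induct [case_names monomial add]:
  fixes F :: "'n mpoly"
  assumes single: "\<And>\<mu> c. P (Poly_Mapping.single \<mu> c)"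
    and add: "\<And>F G. P F \<Longrightarrow> P G \<Longrightarrow> P (F + G)"
  shows "P F"
proof (induction F rule: Poly_Mapping.update_induct)
  case const
  show ?case using single[of 0 0] by simp
next
  case (update F \<mu> c)
  have "Poly_Mapping.update \<mu> c F = Poly_Mapping.single \<mu> c + F"
    using update(1) by (intro poly_mapping_eqI)
      (auto simp: lookup_update lookup_add lookup_single not_in_keys_iff_lookup_eq_zero when_def)
  then show ?case using add[OF single update(3)] by simp
qed

text \<open>
  A map on terms \<open>c x^\<mu>\<close> extends additively to all polynomials. Evaluation and the grading are both
  of this form, so that both are ring homomorphisms by the same lemma.
\<close>

definition monomial_sum ::
    "(('n \<Rightarrow>\<^sub>0 nat) \<Rightarrow> real \<Rightarrow> 'b::comm_monoid_add) \<Rightarrow> 'n mpoly \<Rightarrow> 'b" where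
  "monomial_sum \<phi> F = (\<Sum>\<mu>\<in>Poly_Mapping.keys F. \<phi> \<mu> (Poly_Mapping.lookup F \<mu>))"

lemma monomial_sum_superset:
  assumes "finite X" "Poly_Mapping.keys F \<subseteq> X" "\<And>\<mu>. \<phi> \<mu> 0 = 0"
  shows "monomial_sum \<phi> F = (\<Sum>\<mu>\<in>X. \<phi> \<mu> (Poly_Mapping.lookup F \<mu>))"
  unfolding monomial_sum_def using assms
  by (intro sum.mono_neutral_left) (auto simp: in_keys_iff)

lemma comm_ring_hom_monomial_sum:
  fixes \<phi> :: "('n \<Rightarrow>\<^sub>0 nat) \<Rightarrow> real \<Rightarrow> 'b::comm_ring_1"
  assumes add: "\<And>\<mu> c d. \<phi> \<mu> (c + d) = \<phi> \<mu> c + \<phi> \<mu> d"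
    and mult: "\<And>\<mu> \<nu> c d. \<phi> (\<mu> + \<nu>) (c * d) = \<phi> \<mu> c * \<phi> \<nu> d"
    and one: "\<phi> 0 1 = 1"
  shows "comm_ring_hom (monomial_sum \<phi>)"
    and "monomial_sum \<phi> (Poly_Mapping.single \<mu> c) = \<phi> \<mu> c"
proof -
  have zero: "\<phi> \<mu> 0 = 0" for \<mu> using add[of \<mu> 0 0] by simp
  have single: "monomial_sum \<phi> (Poly_Mapping.single \<mu> c) = \<phi> \<mu> c" for \<mu> c
    using zero by (simp add: monomial_sum_def)
  show "monomial_sum \<phi> (Poly_Mapping.single \<mu> c) = \<phi> \<mu> c" by (rule single)
  have plus: "monomial_sum \<phi> (F + G) = monomial_sum \<phi> F + monomial_sum \<phi> G" for F G
  proof -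
    let ?X = "Poly_Mapping.keys F \<union> Poly_Mapping.keys G"
    have "monomial_sum \<phi> H = (\<Sum>\<mu>\<in>?X. \<phi> \<mu> (Poly_Mapping.lookup H \<mu>))"
      if "Poly_Mapping.keys H \<subseteq> ?X" for H
      using that zero by (intro monomial_sum_superset) auto
    then show ?thesis
      using keys_add[of F G] by (simp add: lookup_add add sum.distrib)
  qed
  have times: "monomial_sum \<phi> (F * G) = monomial_sum \<phi> F * monomial_sum \<phi> G" for F G
  proof (induction F rule: mpoly_induct)
    case (monomial \<mu> c)
    show ?case
      by (induction G rule: mpoly_induct) (auto simp: mult_single single mult plus distrib_left)
  next
    case (add F1 F2)
    then show ?case by (simp add: plus distrib_right)
  qed
  have "monomial_sum \<phi> 1 = 1" using single[of 0 1] one by simp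
  moreover have "monomial_sum \<phi> 0 = 0" by (simp add: monomial_sum_def)
  ultimately show "comm_ring_hom (monomial_sum \<phi>)"
    using plus times by unfold_locales auto
qed

lemma comm_ring_hom_meval: "comm_ring_hom (\<lambda>F. meval F s)"
  and meval_single: "meval (Poly_Mapping.single \<mu> c) s =
    c * (\<Prod>j\<in>UNIV. vec_nth s j ^ Poly_Mapping.lookup \<mu> j)"
proof -
  let ?\<phi> = "\<lambda>\<mu> c. c * (\<Prod>j\<in>UNIV. vec_nth s j ^ Poly_Mapping.lookup \<mu> j)"
  have eq: "(\<lambda>F. meval F s) = monomial_sum ?\<phi>"
    by (simp add: fun_eq_iff meval_def monomial_sum_def)
  have add: "?\<phi> \<mu> (c + d) = ?\<phi> \<mu> c + ?\<phi> \<mu> d" for \<mu> c d by (rule distrib_right)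
  have mult: "?\<phi> (\<mu> + \<nu>) (c * d) = ?\<phi> \<mu> c * ?\<phi> \<nu> d" for \<mu> \<nu> c d
    by (simp add: lookup_add power_add prod.distrib)
  have one: "?\<phi> 0 1 = 1" by simp
  show "comm_ring_hom (\<lambda>F. meval F s)"
    unfolding eq by (rule comm_ring_hom_monomial_sum(1)[OF add mult one])
  show "meval (Poly_Mapping.single \<mu> c) s = ?\<phi> \<mu> c"
    using comm_ring_hom_monomial_sum(2)[of ?\<phi>, OF add mult one] fun_cong[OF eq] by simp
qed

lemma meval_0 [simp]: "meval 0 s = 0"
  by (simp add: meval_def)

lemma meval_mconst [simp]: "meval (mconst c) s = c"
  by (simp add: mconst_def meval_single)

lemma meval_mvar [simp]: "meval (mvar j) s = vec_nth s j"
proof -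
  have "(\<Prod>i\<in>UNIV. vec_nth s i ^ Poly_Mapping.lookup (Poly_Mapping.single j 1) i) =
      (\<Prod>i\<in>UNIV. if i = j then vec_nth s i else 1)"
    by (intro prod.cong) (auto simp: lookup_single when_def)
  then show ?thesis by (simp add: mvar_def meval_single)
qed

lemma comm_ring_hom_mconst: "comm_ring_hom (mconst :: real \<Rightarrow> 'n mpoly)"
  by unfold_locales (auto simp: mconst_def single_add mult_single)

lemma mconst_eq_iff: "mconst c = (mconst d :: ('n::finite) mpoly) \<longleftrightarrow> c = d"
proof
  assume "mconst c = (mconst d :: 'n mpoly)"
  then have "meval (mconst c :: 'n mpoly) 0 = meval (mconst d :: 'n mpoly) 0" by simp
  then show "c = d" by (simp only: meval_mconst)
qed simp

lemma mconst_eq_0_iff: "mconst c = (0 :: ('n::finite) mpoly) \<longleftrightarrow> c = 0"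
  using mconst_eq_iff[of c 0, where 'n = 'n] by (simp add: mconst_def)

lemma single_eq_mconst_times_mvars:
  "Poly_Mapping.single \<mu> c = mconst c * (\<Prod>j\<in>UNIV. mvar j ^ Poly_Mapping.lookup \<mu> j)"
  for \<mu> :: "'n::finite \<Rightarrow>\<^sub>0 nat"
proof -
  have pow: "mvar j ^ k = Poly_Mapping.single (Poly_Mapping.single j k) 1" for j :: 'n and k
    by (induction k) (auto simp: mvar_def mult_single single_add[symmetric] single_one)
  have "(\<Prod>j\<in>J. mvar j ^ Poly_Mapping.lookup \<mu> j) =
      Poly_Mapping.single (\<Sum>j\<in>J. Poly_Mapping.single j (Poly_Mapping.lookup \<mu> j)) 1" for J
    by (induction J rule: infinite_finite_induct) (auto simp: pow mult_single)
  moreover have "(\<Sum>j\<in>UNIV. Poly_Mapping.single j (Poly_Mapping.lookup \<mu> j)) = \<mu>"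
    by (rule poly_mapping_eqI) (simp add: lookup_sum lookup_single when_def)
  ultimately show ?thesis by (simp add: mconst_def mult_single)
qed

text \<open>
  The polynomials in the variables of a list, generated by one variable after the other so that
  they match the one-variable theory above.
\<close>

fun poly_ring :: "'n list \<Rightarrow> 'n mpoly set" where
  "poly_ring [] = range mconst"
| "poly_ring (j # js) = (\<lambda>p. poly p (mvar j)) ` polys_over (poly_ring js)"

lemma factorial_in_range_mconst: "factorial_in (range mconst :: ('n::finite) mpoly set)"
proof -
  interpret comm_ring_hom "mconst :: real \<Rightarrow> 'n mpoly" by (rule comm_ring_hom_mconst)
  have dom: "domain_in (range mconst :: 'n mpoly set)"
    unfolding domain_in_def
    by (auto simp: hom_mult[symmetric] hom_minus[symmetric] mconst_eq_0_iff simp flip: hom_one)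
  moreover have "prime_product (range mconst) 0 a"
    if a: "a \<in> range mconst" "a \<noteq> 0" for a :: "'n mpoly"
  proof -
    obtain c where c: "a = mconst c" using a by blast
    have "1 = a * mconst (inverse c)"
      using a by (simp add: c mconst_eq_0_iff flip: hom_mult)
    then show ?thesis
      using a by (intro prime_product.unit) (auto simp: unit_in_def divides_in_def)
  qed
  ultimately show ?thesis unfolding factorial_in_def by blast
qed

lemma meval_poly:
  "meval (poly p x) s = poly (map_poly (\<lambda>F. meval F s) p) (meval x s)"
proof -
  interpret comm_ring_hom "\<lambda>F. meval F s" by (rule comm_ring_hom_meval)
  show ?thesis by (induction p) (auto simp: map_poly_pCons hom_add hom_mult)
qed

lemma map_poly_meval_cong:
  assumes "p \<in> polys_over S" "\<And>F. F \<in> S \<Longrightarrow> meval F s = meval F s'"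
  shows "map_poly (\<lambda>F. meval F s) p = map_poly (\<lambda>F. meval F s') p"
proof (rule poly_eqI)
  fix k
  have "coeff p k \<in> S" using assms(1) unfolding polys_over_def by blast
  from assms(2)[OF this]
  show "coeff (map_poly (\<lambda>F. meval F s) p) k = coeff (map_poly (\<lambda>F. meval F s') p) k"
    by (simp add: coeff_map_poly)
qed

lemma meval_poly_ring_cong:
  assumes "F \<in> poly_ring js" "\<And>i. i \<in> set js \<Longrightarrow> vec_nth s i = vec_nth s' i"
  shows "meval F s = meval F s'"
  using assms
proof (induction js arbitrary: F)
  case (Cons j js)
  then obtain p where p: "F = poly p (mvar j)" "p \<in> polys_over (poly_ring js)" by auto
  have "map_poly (\<lambda>G. meval G s) p = map_poly (\<lambda>G. meval G s') p"
    by (rule map_poly_meval_cong[OF p(2)]) (rule Cons.IH, simp_all add: Cons.prems(2))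
  moreover have "vec_nth s j = vec_nth s' j" by (rule Cons.prems(2)) simp
  ultimately show ?case unfolding p(1) meval_poly by simp
next
  case Nil
  then obtain c where "F = mconst c" by auto
  then show ?case by simp
qed

text \<open>
  Values of the coefficients do not depend on \<open>s\<^sub>j\<close>. With the other coordinates fixed, the
  polynomial in \<open>s\<^sub>j\<close> has all \<open>t \<ge> 0\<close> as zeros, so all its coefficients vanish there. This gives both
  the injectivity of substituting \<^term>\<open>mvar j\<close> for the indeterminate and the next step of the
  induction showing that a polynomial vanishing on the orthant is zero.
\<close>

lemma poly_mvar_vanishes:
  assumes vanish: "\<And>F. F \<in> poly_ring js \<Longrightarrow> (\<And>s. s \<in> nonneg_orthant \<Longrightarrow> meval F s = 0) \<Longrightarrow> F = 0"
    and "j \<notin> set js" "p \<in> polys_over (poly_ring js)"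
    and zero: "\<And>s. s \<in> nonneg_orthant \<Longrightarrow> meval (poly p (mvar j)) s = 0"
  shows "p = 0"
proof (rule poly_eqI)
  fix k
  have "meval (coeff p k) s = 0" if s: "s \<in> nonneg_orthant" for s
  proof -
    define q where "q = map_poly (\<lambda>F. meval F s) p"
    have "poly q t = 0" if "t \<ge> 0" for t
    proof -
      define s' where "s' = (\<chi> i. if i = j then t else vec_nth s i)"
      have "meval F s' = meval F s" if "F \<in> poly_ring js" for F
        using that \<open>j \<notin> set js\<close> by (intro meval_poly_ring_cong[of F js]) (auto simp: s'_def)
      then have "map_poly (\<lambda>F. meval F s') p = q"
        unfolding q_def by (rule map_poly_meval_cong[OF assms(3)])
      moreover have "s' \<in> nonneg_orthant"
        using s \<open>t \<ge> 0\<close> by (auto simp: s'_def nonneg_orthant_def)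
      ultimately have "poly q (vec_nth s' j) = 0"
        using zero[of s'] by (simp only: meval_poly meval_mvar)
      then show ?thesis by (simp add: s'_def)
    qed
    then have "{0..} \<subseteq> {t. poly q t = 0}" by auto
    then have "infinite {t. poly q t = 0}"
      using infinite_Ici[of "0::real"] finite_subset by metis
    then have "q = 0" using poly_roots_finite[of q] by metis
    then show ?thesis by (simp add: q_def coeff_map_poly poly_eq_iff)
  qed
  then show "coeff p k = coeff 0 k"
    using vanish[of "coeff p k"] assms(3) by (simp add: polys_over_def)
qed

lemma poly_ring_properties:
  assumes "distinct js"
  shows factorial_in_poly_ring: "factorial_in (poly_ring js)"
    and poly_ring_vanish: "\<And>F. F \<in> poly_ring js \<Longrightarrow>
      (\<And>s. s \<in> nonneg_orthant \<Longrightarrow> meval F s = 0) \<Longrightarrow> F = 0"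
proof -
  have "factorial_in (poly_ring js) \<and> (\<forall>F\<in>poly_ring js. (\<forall>s\<in>nonneg_orthant. meval F s = 0) \<longrightarrow> F = 0)"
    using assms
  proof (induction js)
    case Nil
    have "0 \<in> nonneg_orthant" by (simp add: nonneg_orthant_def)
    moreover have "mconst 0 = 0" by (simp add: mconst_def)
    ultimately show ?case using factorial_in_range_mconst by auto
  next
    case (Cons j js)
    then have fac: "factorial_in (poly_ring js)"
      and vanish: "\<And>F. F \<in> poly_ring js \<Longrightarrow> (\<And>s. s \<in> nonneg_orthant \<Longrightarrow> meval F s = 0) \<Longrightarrow> F = 0"
      and "j \<notin> set js" by auto
    note zero = poly_mvar_vanishes[OF vanish \<open>j \<notin> set js\<close>]
    have dom: "domain_in (poly_ring js)" using fac by (simp add: factorial_in_def)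
    have "inj_on (\<lambda>p. poly p (mvar j)) (polys_over (poly_ring js))"
    proof (rule inj_onI)
      fix p q assume pq: "p \<in> polys_over (poly_ring js)" "q \<in> polys_over (poly_ring js)"
        "poly p (mvar j) = poly q (mvar j)"
      have "p - q = 0"
        using pq by (intro zero polys_over_diff[OF dom]) simp_all
      then show "p = q" by simp
    qed
    then have "factorial_in (poly_ring (j # js))"
      unfolding poly_ring.simps
      by (intro factorial_in_image[OF factorial_in_polys_over[OF fac]]) simp_all
    moreover have "F = 0"
      if F: "F \<in> poly_ring (j # js)" "\<forall>s\<in>nonneg_orthant. meval F s = 0" for F
    proof -
      obtain p where p: "p \<in> polys_over (poly_ring js)" "F = poly p (mvar j)"
        using F(1) by auto
      then have "p = 0" using F(2) by (intro zero) auto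
      then show "F = 0" using p by simp
    qed
    ultimately show ?case by blast
  qed
  note * = this
  show "factorial_in (poly_ring js)" using * by (rule conjunct1)
  fix F assume "F \<in> poly_ring js" "\<And>s. s \<in> nonneg_orthant \<Longrightarrow> meval F s = 0"
  then show "F = 0" using conjunct2[OF *] by simp
qed

lemma domain_in_poly_ring:
  "distinct js \<Longrightarrow> domain_in (poly_ring js)" for js :: "'n::finite list"
  using factorial_in_poly_ring unfolding factorial_in_def by blast

lemma mconst_in_poly_ring:
  fixes js :: "'n::finite list"
  assumes "distinct js" shows "mconst c \<in> poly_ring js"
  using assms
proof (induction js)
  case (Cons j js)
  then have "mconst c \<in> poly_ring js" "domain_in (poly_ring js)"
    using domain_in_poly_ring[of js] by simp_all
  then have "[:mconst c:] \<in> polys_over (poly_ring js)"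
    by (simp only: polys_over_const)
  moreover have "mconst c = poly [:mconst c:] (mvar j)" by simp
  ultimately show ?case unfolding poly_ring.simps by (rule rev_image_eqI)
qed simp

lemma mvar_in_poly_ring:
  fixes js :: "'n::finite list"
  assumes "distinct js" "j \<in> set js" shows "mvar j \<in> poly_ring js"
  using assms
proof (induction js)
  case (Cons i js)
  then have dom: "domain_in (poly_ring js)" using domain_in_poly_ring[of js] by simp
  show ?case
  proof (cases "j = i")
    case True
    have "[:0, 1:] \<in> polys_over (poly_ring js)"
      using domain_in_0[OF dom] domain_in_1[OF dom] polys_over_const[OF dom, of 1]
      by (simp add: polys_over_pCons[OF dom])
    moreover have "mvar j = poly [:0, 1:] (mvar i)" using True by simp
    ultimately show ?thesis unfolding poly_ring.simps by (rule rev_image_eqI)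
  next
    case False
    then have "mvar j \<in> poly_ring js" using Cons by simp
    then have "[:mvar j:] \<in> polys_over (poly_ring js)" by (simp only: polys_over_const[OF dom])
    moreover have "mvar j = poly [:mvar j:] (mvar i)" by simp
    ultimately show ?thesis unfolding poly_ring.simps by (rule rev_image_eqI)
  qed
qed simp

lemma poly_ring_all_variables:
  assumes "distinct js" "set js = (UNIV :: 'n::finite set)"
  shows "poly_ring js = UNIV"
proof -
  note dom = domain_in_poly_ring[OF assms(1)]
  have "F \<in> poly_ring js" for F
  proof (induction F rule: mpoly_induct)
    case (monomial \<mu> c)
    show ?case
      unfolding single_eq_mconst_times_mvars using assms
      by (intro domain_in_mult[OF dom] domain_in_prod[OF dom] domain_in_power[OF dom]
          mconst_in_poly_ring mvar_in_poly_ring) auto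
  next
    case (add F G)
    then show ?case by (rule domain_in_add[OF dom])
  qed
  then show ?thesis by auto
qed

lemma factorial_in_mpoly: "factorial_in (UNIV :: ('n::finite) mpoly set)"
  and mpoly_eq_0I: "(\<And>s. s \<in> nonneg_orthant \<Longrightarrow> meval F s = 0) \<Longrightarrow> F = (0 :: 'n mpoly)"
proof -
  obtain js :: "'n list" where js: "distinct js" "set js = UNIV"
    using finite_distinct_list[OF finite_class.finite_UNIV] by blast
  note all = poly_ring_all_variables[OF js]
  show "factorial_in (UNIV :: 'n mpoly set)"
    using factorial_in_poly_ring[OF js(1)] unfolding all .
  show "(\<And>s. s \<in> nonneg_orthant \<Longrightarrow> meval F s = 0) \<Longrightarrow> F = 0"
    using poly_ring_vanish[OF js(1)] unfolding all by blast
qed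

lemma domain_in_mpoly: "domain_in (UNIV :: ('n::finite) mpoly set)"
  using factorial_in_mpoly unfolding factorial_in_def by blast

lemma mpoly_mult_eq_0_iff: "F * G = 0 \<longleftrightarrow> F = 0 \<or> G = 0" for F G :: "('n::finite) mpoly"
  using domain_in_no_zero_divisors[OF domain_in_mpoly UNIV_I UNIV_I, of F G] by auto

text \<open>
  The form in which unique factorization enters the main argument, with the minimal denominator for
  \<open>q\<close> and then with a divisor of a product of linear forms.
\<close>

lemma mpoly_dvd_mult_decompose:
  fixes q f g :: "('n::finite) mpoly"
  assumes "q \<noteq> 0" "q dvd f * g"
  shows "\<exists>q1 q2. q = q1 * q2 \<and> q1 dvd f \<and> q2 dvd g"
proof -
  obtain h where h: "q * h = f * g" using assms(2) by (metis dvdE)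
  obtain n where n: "prime_product UNIV n q"
    using factorial_in_mpoly assms(1) unfolding factorial_in_def by blast
  from prime_product_divides_mult[OF domain_in_mpoly n UNIV_I UNIV_I UNIV_I h]
  obtain q1 q2 f' g' where "q = q1 * q2" "f = q1 * f'" "g = q2 * g'" by blast
  then show ?thesis using dvd_triv_left by blast
qed

section \<open>Leading homogeneous parts\<close>

text \<open>
  The substitution \<open>s\<^sub>j \<mapsto> s\<^sub>j X\<close>. The coefficient of \<open>X^k\<close> is the homogeneous part of degree \<open>k\<close>, so the
  leading homogeneous part becomes a leading coefficient and is multiplicative for that reason.
\<close>

definition grading :: "('n::finite) mpoly \<Rightarrow> 'n mpoly poly" where
  "grading = monomial_sum (\<lambda>\<mu> c. monom (Poly_Mapping.single \<mu> c) (monom_degree \<mu>))"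

lemma comm_ring_hom_grading: "comm_ring_hom (grading :: ('n::finite) mpoly \<Rightarrow> _)"
  and grading_single: "grading (Poly_Mapping.single (\<mu> :: 'n \<Rightarrow>\<^sub>0 nat) c) =
    monom (Poly_Mapping.single \<mu> c) (monom_degree \<mu>)"
proof -
  let ?\<phi> = "\<lambda>(\<mu> :: 'n \<Rightarrow>\<^sub>0 nat) (c :: real). monom (Poly_Mapping.single \<mu> c) (monom_degree \<mu>)"
  have add: "?\<phi> \<mu> (c + d) = ?\<phi> \<mu> c + ?\<phi> \<mu> d" for \<mu> c d by (simp add: single_add add_monom)
  have mult: "?\<phi> (\<mu> + \<nu>) (c * d) = ?\<phi> \<mu> c * ?\<phi> \<nu> d" for \<mu> \<nu> c d
    by (simp add: mult_single mult_monom monom_degree_def lookup_add sum.distrib)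
  have one: "?\<phi> 0 1 = 1" by (simp add: monom_degree_def)
  show "comm_ring_hom (grading :: 'n mpoly \<Rightarrow> _)"
    unfolding grading_def by (rule comm_ring_hom_monomial_sum(1)[OF add mult one])
  show "grading (Poly_Mapping.single \<mu> c) = ?\<phi> \<mu> c"
    unfolding grading_def by (rule comm_ring_hom_monomial_sum(2)[of ?\<phi>, OF add mult one])
qed

lemma grading_mconst: "grading (mconst c) = [:mconst c:]"
  by (simp add: mconst_def grading_single monom_degree_def monom_0)

lemma grading_mvar: "grading (mvar j) = monom (mvar j) 1"
  by (simp add: mvar_def grading_single monom_degree_def lookup_single when_def)

lemma lookup_coeff_grading:
  "Poly_Mapping.lookup (coeff (grading F) k) \<mu> = (Poly_Mapping.lookup F \<mu> when monom_degree \<mu> = k)"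
proof -
  interpret comm_ring_hom "grading :: 'a mpoly \<Rightarrow> _" by (rule comm_ring_hom_grading)
  show ?thesis
    by (induction F rule: mpoly_induct)
      (auto simp: grading_single lookup_single hom_add lookup_add when_def)
qed

lemma degree_grading:
  assumes "F \<noteq> 0"
  shows "degree (grading F) = total_degree F" 
    and "lead_coeff (grading F) \<noteq> 0"
proof -
  have "Poly_Mapping.keys F \<noteq> {}" using assms by simp
  then have "total_degree F \<in> monom_degree ` Poly_Mapping.keys F"
    unfolding total_degree_def by (intro Max_in) auto
  then obtain \<mu> where "\<mu> \<in> Poly_Mapping.keys F" "monom_degree \<mu> = total_degree F"
    by (metis imageE)
  then have "Poly_Mapping.lookup (coeff (grading F) (total_degree F)) \<mu> \<noteq> 0"
    by (simp add: lookup_coeff_grading in_keys_iff)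
  then have nz: "coeff (grading F) (total_degree F) \<noteq> 0" by auto
  moreover have "coeff (grading F) k = 0" if "k > total_degree F" for k
  proof (rule poly_mapping_eqI)
    fix \<mu>
    have "\<mu> \<in> Poly_Mapping.keys F \<Longrightarrow> monom_degree \<mu> \<le> total_degree F"
      unfolding total_degree_def by (intro Max_ge) auto
    then show "Poly_Mapping.lookup (coeff (grading F) k) \<mu> = Poly_Mapping.lookup 0 \<mu>"
      using that by (cases "Poly_Mapping.lookup F \<mu> = 0")
        (auto simp: lookup_coeff_grading when_def in_keys_iff)
  qed
  ultimately show "degree (grading F) = total_degree F"
    by (metis degree_le le_antisym le_degree)
  then show "lead_coeff (grading F) \<noteq> 0" using nz by simp
qed

lemma leading_part_eq_lead_coeff: "leading_part F = lead_coeff (grading F)"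
proof (cases "F = 0")
  case True
  then show ?thesis by (simp add: leading_part_def grading_def monomial_sum_def)
next
  case False
  show ?thesis
  proof (rule poly_mapping_eqI)
    fix \<mu>
    have "Poly_Mapping.lookup (leading_part F) \<mu> =
        (\<Sum>\<nu> | \<nu> \<in> Poly_Mapping.keys F \<and> monom_degree \<nu> = total_degree F.
          if \<nu> = \<mu> then Poly_Mapping.lookup F \<mu> else 0)"
      unfolding leading_part_def lookup_sum by (intro sum.cong) (auto simp: lookup_single when_def)
    also have "\<dots> = Poly_Mapping.lookup (lead_coeff (grading F)) \<mu>"
      unfolding lookup_coeff_grading degree_grading(1)[OF False] by (auto simp: when_def in_keys_iff)
    finally show "Poly_Mapping.lookup (leading_part F) \<mu> = Poly_Mapping.lookup (lead_coeff (grading F)) \<mu>" .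
  qed
qed

lemma grading_mult_nonzero:
  fixes F G :: "('n::finite) mpoly"
  assumes "F \<noteq> 0" "G \<noteq> 0"
  shows "degree (grading (F * G)) = degree (grading F) + degree (grading G)"
    and "leading_part (F * G) = leading_part F * leading_part G"
proof -
  interpret comm_ring_hom "grading :: 'n mpoly \<Rightarrow> _" by (rule comm_ring_hom_grading)
  have "grading F \<noteq> 0" "grading G \<noteq> 0" using degree_grading(2) assms by fastforce+
  then show "degree (grading (F * G)) = degree (grading F) + degree (grading G)"
    and "leading_part (F * G) = leading_part F * leading_part G"
    using polys_over_degree_mult[OF domain_in_mpoly, of "grading F" "grading G"]
    by (auto simp: hom_mult leading_part_eq_lead_coeff polys_over_def)
qed

lemma degree_grading_0:
  assumes "degree (grading F) = 0"
  shows "\<exists>c. F = mconst c"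
proof -
  have "F = mconst (Poly_Mapping.lookup F 0)"
  proof (rule poly_mapping_eqI)
    fix \<mu> :: "'a \<Rightarrow>\<^sub>0 nat"
    show "Poly_Mapping.lookup F \<mu> = Poly_Mapping.lookup (mconst (Poly_Mapping.lookup F 0)) \<mu>"
    proof (cases "\<mu> = 0")
      case False
      then obtain j where "Poly_Mapping.lookup \<mu> j \<noteq> 0" by (metis lookup_zero poly_mapping_eqI)
      then have "monom_degree \<mu> \<noteq> 0" by (auto simp: monom_degree_def)
      then have "coeff (grading F) (monom_degree \<mu>) = 0" using assms by (simp add: coeff_eq_0)
      then have "Poly_Mapping.lookup F \<mu> = 0"
        using lookup_coeff_grading[of F "monom_degree \<mu>" \<mu>] by simp
      then show ?thesis using False by (simp add: mconst_def lookup_single when_def)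
    qed (simp add: mconst_def)
  qed
  then show ?thesis ..
qed

section \<open>Restrictions of transient subgenerators\<close>

lemma mult_mat_vec_sum:
  assumes "A \<in> carrier_mat m m" "v \<in> carrier_vec m" "i < m"
  shows "Matrix.vec_index (A *\<^sub>v v) i = (\<Sum>j<m. A $$ (i, j) * Matrix.vec_index v j)"
  using assms by (simp add: scalar_prod_def atLeast0LessThan)

text \<open>
  Rows in a closed class \<open>C\<close> only see entries in \<open>C\<close>, so vectors vanishing on \<open>C\<close> are preserved.
\<close>

lemma pow_mat_vec_eq_0:
  assumes T: "T \<in> carrier_mat m m" and "C \<subseteq> {..<m}"
    and closed: "\<And>i j. i \<in> C \<Longrightarrow> j < m \<Longrightarrow> j \<notin> C \<Longrightarrow> T $$ (i, j) = (0 :: real)"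
    and "w \<in> carrier_vec m" "\<And>i. i \<in> C \<Longrightarrow> Matrix.vec_index w i = 0" "i \<in> C"
  shows "Matrix.vec_index ((T ^\<^sub>m k) *\<^sub>v w) i = 0"
  using assms(4-6)
proof (induction k arbitrary: w)
  case 0
  then show ?case using T by simp
next
  case (Suc k)
  have "Matrix.vec_index (T *\<^sub>v w) j = 0" if "j \<in> C" for j
  proof -
    have "Matrix.vec_index (T *\<^sub>v w) j = (\<Sum>l<m. T $$ (j, l) * Matrix.vec_index w l)"
      using \<open>C \<subseteq> {..<m}\<close> that Suc.prems by (intro mult_mat_vec_sum[OF T]) auto
    also have "\<dots> = 0"
      using closed[OF that] Suc.prems(2) by (intro sum.neutral ballI) auto
    finally show ?thesis .
  qed
  moreover have "T *\<^sub>v w \<in> carrier_vec m" using T Suc.prems(1) by (rule mult_mat_vec_carrier)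
  ultimately have "Matrix.vec_index ((T ^\<^sub>m k) *\<^sub>v (T *\<^sub>v w)) i = 0"
    using Suc.IH Suc.prems(3) by blast
  moreover have "(T ^\<^sub>m Suc k) *\<^sub>v w = (T ^\<^sub>m k) *\<^sub>v (T *\<^sub>v w)"
    using T Suc.prems(1) by (simp add: assoc_mult_mat_vec[of _ m m _ m])
  ultimately show ?case by simp
qed

text \<open>
  Started in a closed class with row sums zero the chain never leaves it and is never absorbed:
  \<open>T 1\<close> vanishes on \<open>C\<close>, hence so does \<open>T^k 1\<close> for all \<open>k > 0\<close>, and the survival probability is
  constantly one.
\<close>

lemma transient_no_closed_conservative_class:
  assumes T: "transient_subgenerator m T" and C: "C \<subseteq> {..<m}" "C \<noteq> {}"
    and closed: "\<And>i j. i \<in> C \<Longrightarrow> j < m \<Longrightarrow> j \<notin> C \<Longrightarrow> T $$ (i, j) = 0"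
    and conservative: "\<And>i. i \<in> C \<Longrightarrow> (\<Sum>j<m. T $$ (i, j)) = 0"
  shows False
proof -
  have carrier: "T \<in> carrier_mat m m" using T by (simp add: transient_subgenerator_def)
  obtain i where i: "i \<in> C" using C by blast
  then have "i < m" using C by blast
  have ones: "ones_vec m \<in> carrier_vec m" by (simp add: ones_vec_def)
  define w where "w = T *\<^sub>v ones_vec m"
  have w: "w \<in> carrier_vec m" unfolding w_def using carrier ones by (rule mult_mat_vec_carrier)
  have "Matrix.vec_index w j = 0" if "j \<in> C" for j
  proof -
    have "j < m" using C that by blast
    then have "Matrix.vec_index w j = (\<Sum>l<m. T $$ (j, l) * Matrix.vec_index (ones_vec m) l)"
      unfolding w_def by (rule mult_mat_vec_sum[OF carrier ones])
    then show ?thesis using conservative[OF that] by (simp add: ones_vec_def)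
  qed
  note vanish = pow_mat_vec_eq_0[OF carrier C(1) closed w this i]
  \<comment> \<open>Only the term of degree zero in the exponential series survives.\<close>
  have power_ones: "Matrix.vec_index ((T ^\<^sub>m k) *\<^sub>v ones_vec m) i = (if k = 0 then 1 else 0)" for k
  proof (cases k)
    case 0
    then show ?thesis using carrier ones \<open>i < m\<close> by (simp add: ones_vec_def)
  next
    case (Suc l)
    have "(T ^\<^sub>m Suc l) *\<^sub>v ones_vec m = (T ^\<^sub>m l) *\<^sub>v w"
      unfolding w_def using carrier ones by (simp add: assoc_mult_mat_vec[of _ m m _ m])
    then show ?thesis using vanish Suc by simp
  qed
  have "survival_prob T i t = 1" for t
  proof -
    have "survival_prob T i t =
        suminf (\<lambda>k. t ^ k / fact k * Matrix.vec_index ((T ^\<^sub>m k) *\<^sub>v ones_vec m) i)"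
      unfolding survival_prob_def using carrier by simp
    also have "\<dots> = (\<Sum>k\<in>{0}. t ^ k / fact k * Matrix.vec_index ((T ^\<^sub>m k) *\<^sub>v ones_vec m) i)"
      unfolding power_ones by (rule suminf_finite) auto
    also have "\<dots> = 1" unfolding power_ones by simp
    finally show ?thesis .
  qed
  then have "survival_prob T i = (\<lambda>_. 1)" by (rule ext)
  moreover have "(survival_prob T i \<longlongrightarrow> 0) at_top"
    using T \<open>i < m\<close> by (simp add: transient_subgenerator_def)
  ultimately show False by (simp add: tendsto_const_iff)
qed

text \<open>
  A maximum principle. The determinant of \<open>M\<close> is a principal minor of \<open>-T\<close>, on the indices in \<open>Z\<close>. Let \<open>x\<close> be a
  kernel vector of \<open>M\<close>; it is supported on \<open>Z\<close>. Equality must hold throughout the estimate of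
  \<open>(T x)\<^sub>i\<close> at an index \<open>i\<close> where \<open>\<bar>x\<^sub>i\<bar>\<close> is maximal. So row \<open>i\<close> has sum zero and leads only to
  indices where the maximum is attained as well, and these indices form a closed class without
  absorption, which transience excludes.
\<close>

lemma transient_subgenerator_restricted_nonsingular:
  assumes T: "transient_subgenerator m T"
    and M: "M = Matrix.mat m m (\<lambda>(i, j). if i \<in> Z then - (T $$ (i, j)) else if i = j then 1 else 0)"
  shows "Determinant.det M \<noteq> (0 :: real)"
proof
  assume "Determinant.det M = 0"
  have carrier: "T \<in> carrier_mat m m" 
    and off: "\<And>i j. i < m \<Longrightarrow> j < m \<Longrightarrow> i \<noteq> j \<Longrightarrow> 0 \<le> T $$ (i, j)"
    and rows: "\<And>i. i < m \<Longrightarrow> (\<Sum>j<m. T $$ (i, j)) \<le> 0"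
    using T by (auto simp: transient_subgenerator_def)
  have M_carrier: "M \<in> carrier_mat m m" using M by simp
  from \<open>Determinant.det M = 0\<close> obtain v where v: "v \<in> carrier_vec m" "v \<noteq> 0\<^sub>v m" "M *\<^sub>v v = 0\<^sub>v m"
    using det_0_iff_vec_prod_zero[OF M_carrier] by blast
  define x where "x = Matrix.vec_index v"
  have ker: "(\<Sum>j<m. M $$ (i, j) * x j) = 0" if "i < m" for i
    using mult_mat_vec_sum[OF M_carrier v(1) that] v(3) that by (simp add: x_def)
  define a where "a = Max ((\<lambda>i. \<bar>x i\<bar>) ` {..<m})"
  have le: "\<bar>x i\<bar> \<le> a" if "i < m" for i
    unfolding a_def using that by (intro Max_ge) auto
  obtain i0 where i0: "i0 < m" "x i0 \<noteq> 0"
    using v(1,2) unfolding x_def by (metis carrier_vecD eq_vecI index_zero_vec(1,2))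
  have "a > 0" using le[OF i0(1)] i0(2) by linarith
  define C where "C = {i. i < m \<and> \<bar>x i\<bar> = a}"
  have "a \<in> (\<lambda>i. \<bar>x i\<bar>) ` {..<m}"
    unfolding a_def using i0(1) by (intro Max_in) auto
  then have "C \<noteq> {}" unfolding C_def by auto
  have maximal_row: "(\<Sum>j<m. T $$ (i, j)) = 0 \<and> (\<forall>j<m. j \<notin> C \<longrightarrow> T $$ (i, j) = 0)" if "i \<in> C" for i
  proof -
    have i: "i < m" "\<bar>x i\<bar> = a" using that by (auto simp: C_def)
    have "i \<in> Z"
    proof (rule ccontr)
      assume "i \<notin> Z"
      then have "(\<Sum>j<m. M $$ (i, j) * x j) = (\<Sum>j<m. if j = i then x i else 0)"
        using i(1) by (intro sum.cong) (auto simp: M)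
      also have "\<dots> = x i" using i(1) by simp
      finally show False using ker[OF i(1)] i(2) \<open>a > 0\<close> by simp
    qed
    then have "(\<Sum>j<m. M $$ (i, j) * x j) = - (\<Sum>j<m. T $$ (i, j) * x j)"
      using i(1) by (simp add: M sum_negf)
    then have Tx: "(\<Sum>j<m. T $$ (i, j) * x j) = 0" using ker[OF i(1)] by simp
    \<comment> \<open>The sign makes \<open>\<sigma> x\<^sub>i = a\<close>; then \<open>a - \<sigma> x\<^sub>j \<ge> 0\<close> for every \<open>j\<close>, with equality for \<open>j = i\<close>, so
      the negative entry \<open>T\<^sub>i\<^sub>i\<close> does not contribute to the sum below.\<close>
    define \<sigma> where "\<sigma> = sgn (x i)"
    have \<sigma>: "\<sigma> * x i = a" "\<bar>\<sigma>\<bar> = 1"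
      using i(2) \<open>a > 0\<close> by (auto simp: \<sigma>_def sgn_if abs_if split: if_splits)
    have \<sigma>_le: "\<sigma> * x j \<le> \<bar>x j\<bar>" for j
      using \<sigma>(2) by (metis abs_ge_self abs_mult mult_1)
    have nonneg: "0 \<le> T $$ (i, j) * (a - \<sigma> * x j)" if "j < m" for j
    proof (cases "j = i")
      case True
      then show ?thesis using \<sigma>(1) by simp
    next
      case False
      then show ?thesis
        using off[OF i(1) that] le[OF that] \<sigma>_le[of j] by (intro mult_nonneg_nonneg) auto
    qed
    have "(\<Sum>j<m. T $$ (i, j) * (a - \<sigma> * x j)) =
        a * (\<Sum>j<m. T $$ (i, j)) - \<sigma> * (\<Sum>j<m. T $$ (i, j) * x j)"
      by (simp add: sum_subtractf sum_distrib_left algebra_simps)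
    then have eq: "(\<Sum>j<m. T $$ (i, j) * (a - \<sigma> * x j)) = a * (\<Sum>j<m. T $$ (i, j))"
      using Tx by simp
    also have "\<dots> \<le> 0" using rows[OF i(1)] \<open>a > 0\<close> by (simp add: mult_nonneg_nonpos)
    finally have zero: "(\<Sum>j<m. T $$ (i, j) * (a - \<sigma> * x j)) = 0"
      using sum_nonneg[of "{..<m}" "\<lambda>j. T $$ (i, j) * (a - \<sigma> * x j)"] nonneg by fastforce
    then have "(\<Sum>j<m. T $$ (i, j)) = 0" using eq \<open>a > 0\<close> by simp
    moreover have "T $$ (i, j) = 0" if j: "j < m" "j \<notin> C" for j
    proof -
      have "T $$ (i, j) * (a - \<sigma> * x j) = 0"
        using zero nonneg j(1) sum_nonneg_eq_0_iff[of "{..<m}" "\<lambda>j. T $$ (i, j) * (a - \<sigma> * x j)"]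
        by auto
      moreover have "\<sigma> * x j < a"
        using le[OF j(1)] j \<sigma>_le[of j] by (auto simp: C_def)
      ultimately show ?thesis by simp
    qed
    ultimately show ?thesis by blast
  qed
  show False
    using maximal_row \<open>C \<noteq> {}\<close> by (intro transient_no_closed_conservative_class[OF T, of C]) (auto simp: C_def)
qed

section \<open>The determinant of the resolvent\<close>

lemma coeff_mult_degree_bounds:
  fixes p q :: "'a::comm_ring_1 poly"
  assumes "degree p \<le> m" "degree q \<le> n"
  shows "coeff (p * q) (m + n) = coeff p m * coeff q n"
proof (cases "degree p = m \<and> degree q = n")
  case True
  then show ?thesis using coeff_mult_degree_sum[of p q] by simp
next
  case False
  then have "degree (p * q) < m + n"
    using degree_mult_le[of p q] assms by linarith
  moreover have "coeff p m = 0 \<or> coeff q n = 0"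
    using False assms by (metis coeff_eq_0 le_neq_implies_less)
  ultimately show ?thesis using coeff_eq_0 by fastforce
qed

lemma coeff_prod_degree_bounds:
  fixes f :: "'i \<Rightarrow> 'a::comm_ring_1 poly"
  assumes "finite I" "\<And>i. i \<in> I \<Longrightarrow> degree (f i) \<le> d i"
  shows "degree (prod f I) \<le> sum d I \<and> coeff (prod f I) (sum d I) = (\<Prod>i\<in>I. coeff (f i) (d i))"
  using assms
proof (induction I rule: finite_induct)
  case (insert i I)
  then have IH: "degree (prod f I) \<le> sum d I" "degree (f i) \<le> d i"
    "coeff (prod f I) (sum d I) = (\<Prod>i\<in>I. coeff (f i) (d i))" by auto
  then show ?case
    using insert.hyps coeff_mult_degree_bounds[OF IH(2,1)] degree_mult_le[of "f i" "prod f I"]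
    by auto
qed simp

text \<open>
  If the entries of row \<open>i\<close> have degree at most \<open>d\<^sub>i\<close>, each product in the Leibniz formula takes its
  coefficient of degree \<open>\<Sum> d\<^sub>i\<close> from the coefficients of degree \<open>d\<^sub>i\<close> in each row.
\<close>

lemma coeff_det_degree_bounds:
  fixes A :: "'a::comm_ring_1 poly Matrix.mat"
  assumes A: "A \<in> carrier_mat m m"
    and deg: "\<And>i j. i < m \<Longrightarrow> j < m \<Longrightarrow> degree (A $$ (i, j)) \<le> d i"
  shows "degree (Determinant.det A) \<le> (\<Sum>i<m. d i)"
    and "coeff (Determinant.det A) (\<Sum>i<m. d i) = Determinant.det (Matrix.mat m m (\<lambda>(i, j). coeff (A $$ (i, j)) (d i)))"
proof -
  let ?P = "{p. p permutes {0..<m}}"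
  have perm: "p i < m" if "p permutes {0..<m}" "i < m" for p i
    using permutes_in_image[OF that(1), of i] that(2) by simp
  have bound: "degree (\<Prod>i = 0..<m. A $$ (i, p i)) \<le> (\<Sum>i<m. d i) \<and>
      coeff (\<Prod>i = 0..<m. A $$ (i, p i)) (\<Sum>i<m. d i) = (\<Prod>i = 0..<m. coeff (A $$ (i, p i)) (d i))"
    if "p \<in> ?P" for p
    using coeff_prod_degree_bounds[of "{0..<m}" "\<lambda>i. A $$ (i, p i)" d] deg that
    by (auto simp: lessThan_atLeast0 perm)
  have sgn: "degree (signof p * q) \<le> degree q" "coeff (signof p * q) k = signof p * coeff q k"
    for p :: "nat \<Rightarrow> nat" and q :: "'a poly" and k
    by (auto simp: sign_def)
  show "degree (Determinant.det A) \<le> (\<Sum>i<m. d i)"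
    unfolding det_def'[OF A] using bound sgn(1)
    by (intro degree_sum_le) (auto intro: order_trans finite_permutations)
  have "coeff (Determinant.det A) (\<Sum>i<m. d i) = (\<Sum>p\<in>?P. signof p * (\<Prod>i = 0..<m. coeff (A $$ (i, p i)) (d i)))"
    unfolding det_def'[OF A] coeff_sum sgn(2) using bound by (intro sum.cong) auto
  also have "\<dots> = (\<Sum>p\<in>?P. signof p *
      (\<Prod>i = 0..<m. Matrix.mat m m (\<lambda>(i, j). coeff (A $$ (i, j)) (d i)) $$ (i, p i)))"
    by (intro sum.cong arg_cong2[of _ _ _ _ "(*)"] prod.cong) (auto simp: perm)
  also have "\<dots> = Determinant.det (Matrix.mat m m (\<lambda>(i, j). coeff (A $$ (i, j)) (d i)))"
    by (subst det_def'[of _ m]) simp_all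
  finally show "coeff (Determinant.det A) (\<Sum>i<m. d i) = Determinant.det (Matrix.mat m m (\<lambda>(i, j). coeff (A $$ (i, j)) (d i)))" .
qed

lemma det_scale_rows:
  fixes A :: "'a::comm_ring_1 Matrix.mat"
  assumes A: "A \<in> carrier_mat m m"
  shows "Determinant.det (Matrix.mat m m (\<lambda>(i, j). k i * A $$ (i, j))) = (\<Prod>i<m. k i) * Determinant.det A"
proof -
  let ?P = "{p. p permutes {0..<m}}"
  have perm: "p i < m" if "p permutes {0..<m}" "i < m" for p i
    using permutes_in_image[OF that(1), of i] that(2) by simp
  have "Determinant.det (Matrix.mat m m (\<lambda>(i, j). k i * A $$ (i, j))) =
      (\<Sum>p\<in>?P. signof p * (\<Prod>i = 0..<m. k i * A $$ (i, p i)))"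
    by (subst det_def'[of _ m], simp)
      (intro sum.cong arg_cong2[of _ _ _ _ "(*)"] prod.cong, auto simp: perm)
  also have "\<dots> = (\<Prod>i<m. k i) * Determinant.det A"
    unfolding det_def'[OF A] by (simp add: prod.distrib sum_distrib_left lessThan_atLeast0 ac_simps)
  finally show ?thesis .
qed

definition linear_form :: "real ^ 'n \<Rightarrow> ('n::finite) mpoly" where
  "linear_form v = (\<Sum>j\<in>UNIV. mconst (vec_nth v j) * mvar j)"

lemma meval_linear_form: "meval (linear_form v) s = inner v s"
proof -
  interpret comm_ring_hom "\<lambda>F. meval F s" by (rule comm_ring_hom_meval)
  show ?thesis by (simp add: linear_form_def hom_sum hom_mult inner_vec_def)
qed

lemma linear_form_eq_0_iff: "linear_form v = 0 \<longleftrightarrow> v = 0"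
proof
  assume "linear_form v = 0"
  then have "inner v v = 0" using meval_linear_form[of v v] by simp
  then show "v = 0" by simp
qed (simp add: linear_form_def mconst_def)

lemma prod_linear_forms_nonzero:
  fixes v :: "'i \<Rightarrow> real ^ ('n::finite)"
  assumes "finite I" "\<And>i. i \<in> I \<Longrightarrow> v i \<noteq> 0"
  shows "(\<Prod>i\<in>I. linear_form (v i)) \<noteq> 0"
  using assms
  by (induction I rule: finite_induct) (auto simp: mpoly_mult_eq_0_iff linear_form_eq_0_iff)

lemma grading_linear_form: "grading (linear_form v) = monom (linear_form v) 1"
proof -
  interpret comm_ring_hom "grading :: 'a mpoly \<Rightarrow> _" by (rule comm_ring_hom_grading)
  have "grading (mconst (vec_nth v j) * mvar j) = monom (mconst (vec_nth v j) * mvar j) 1" for j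
    by (simp add: hom_mult grading_mconst grading_mvar smult_monom)
  then show ?thesis
    unfolding linear_form_def by (simp add: hom_sum monom_sum)
qed

text \<open>
  The matrix \<open>-T + \<Delta>(K s)\<close> with \<open>s\<close> indeterminate.
\<close>

definition resolvent_matrix ::
    "nat \<Rightarrow> real Matrix.mat \<Rightarrow> (nat \<Rightarrow> real ^ 'n) \<Rightarrow> ('n::finite) mpoly Matrix.mat" where
  "resolvent_matrix m T K =
     Matrix.mat m m (\<lambda>(i, j). mconst (- (T $$ (i, j))) + (if i = j then linear_form (K i) else 0))"

text \<open>
  After grading, only the diagonal entries of rows with nonzero reward \<open>K i\<close> involve the grading
  variable, and they have degree one. Picking the top coefficient in each row leaves \<open>-T\<close> in the rows
  without reward and \<open>\<langle>K i, s\<rangle>\<close> times a unit vector in the others. That determinant is the product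
  of the linear forms times a principal minor of \<open>-T\<close>, which is nonzero by transience. As this
  coefficient does not vanish, it is the leading one.
\<close>

lemma leading_part_det_resolvent_matrix:
  fixes K :: "nat \<Rightarrow> real ^ ('n::finite)"
  assumes T: "transient_subgenerator m T"
  shows "Determinant.det (resolvent_matrix m T K) \<noteq> 0" (is ?nonzero)
    and "\<exists>\<delta>. \<delta> \<noteq> 0 \<and> leading_part (Determinant.det (resolvent_matrix m T K)) =
      mconst \<delta> * (\<Prod>i | i < m \<and> K i \<noteq> 0. linear_form (K i))" (is ?lead)
proof -
  interpret g: comm_ring_hom "grading :: 'n mpoly \<Rightarrow> _" by (rule comm_ring_hom_grading)
  interpret c: comm_ring_hom "mconst :: real \<Rightarrow> 'n mpoly" by (rule comm_ring_hom_mconst)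
  define A where "A = resolvent_matrix m T K"
  define G where "G = map_mat grading A"
  \<comment> \<open>Row \<open>i\<close> of \<open>G\<close> has degree at most \<open>d i\<close>, and its top coefficients are \<open>k i\<close> times row \<open>i\<close> of \<open>M\<close>.\<close>
  define d where "d i = (if K i = 0 then 0 else 1 :: nat)" for i
  define M where "M = Matrix.mat m m
    (\<lambda>(i, j). if i \<in> {i. K i = 0} then - (T $$ (i, j)) else if i = j then 1 else 0)"
  define k where "k i = (if K i = 0 then 1 else linear_form (K i))" for i
  have G: "G \<in> carrier_mat m m" by (simp add: G_def A_def resolvent_matrix_def)
  have entry: "G $$ (i, j) = [:mconst (- (T $$ (i, j))):] + (if i = j then monom (linear_form (K i)) 1 else 0)"
    if "i < m" "j < m" for i j
    using that by (simp add: G_def A_def resolvent_matrix_def g.hom_add grading_mconst grading_linear_form)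
  have zero_form: "linear_form (0 :: real ^ 'n) = 0" by (simp add: linear_form_eq_0_iff)
  have deg: "degree (G $$ (i, j)) \<le> d i" if "i < m" "j < m" for i j
    unfolding entry[OF that] d_def
    by (auto simp: zero_form intro!: degree_add_le degree_monom_le)
  have "Matrix.mat m m (\<lambda>(i, j). coeff (G $$ (i, j)) (d i)) =
      Matrix.mat m m (\<lambda>(i, j). k i * map_mat mconst M $$ (i, j))"
    by (intro cong_mat) (auto simp: entry d_def k_def M_def zero_form coeff_pCons)
  then have "coeff (Determinant.det G) (\<Sum>i<m. d i) = (\<Prod>i<m. k i) * mconst (Determinant.det M)"
    using coeff_det_degree_bounds(2)[OF G deg] det_scale_rows[of "map_mat mconst M" m k]
    by (simp add: M_def)
  also have "(\<Prod>i<m. k i) = (\<Prod>i | i < m \<and> K i \<noteq> 0. linear_form (K i))"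
    unfolding k_def by (simp add: prod.If_cases Int_def)
  finally have coeff: "coeff (Determinant.det G) (\<Sum>i<m. d i) =
      mconst (Determinant.det M) * (\<Prod>i | i < m \<and> K i \<noteq> 0. linear_form (K i))" by (simp add: mult.commute)
  have "Determinant.det M \<noteq> 0"
    by (rule transient_subgenerator_restricted_nonsingular[OF T M_def])
  have "(\<Prod>i | i < m \<and> K i \<noteq> 0. linear_form (K i)) \<noteq> 0"
    by (rule prod_linear_forms_nonzero) auto
  moreover have "mconst (Determinant.det M) \<noteq> (0 :: 'n mpoly)"
    using \<open>Determinant.det M \<noteq> 0\<close> by (simp add: mconst_eq_0_iff)
  ultimately have nz: "coeff (Determinant.det G) (\<Sum>i<m. d i) \<noteq> 0"
    unfolding coeff by (simp add: mpoly_mult_eq_0_iff)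
  have det: "Determinant.det G = grading (Determinant.det A)" unfolding G_def by (rule g.hom_det)
  then show ?nonzero using nz by (auto simp: A_def)
  have "degree (Determinant.det G) = (\<Sum>i<m. d i)"
    using coeff_det_degree_bounds(1)[OF G deg] nz le_degree le_antisym by blast
  then show ?lead
    using coeff det \<open>Determinant.det M \<noteq> 0\<close> by (auto simp: leading_part_eq_lead_coeff A_def)
qed

section \<open>The transform as a fraction\<close>

text \<open>
  Cramer's rule: the adjugate of the resolvent matrix has polynomial entries, and where the
  determinant does not vanish it is the determinant times the inverse.
\<close>

lemma mph_transform_rational:
  fixes K :: "nat \<Rightarrow> real ^ ('n::finite)"
  assumes \<alpha>: "\<alpha> \<in> carrier_vec m" and T: "T \<in> carrier_mat m m"
  shows "\<exists>N. \<forall>s. meval (Determinant.det (resolvent_matrix m T K)) s \<noteq> 0 \<longrightarrow>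
    mph_transform m \<alpha> T K s * meval (Determinant.det (resolvent_matrix m T K)) s = meval N s"
proof -
  define A where "A = resolvent_matrix m T K"
  have A: "A \<in> carrier_mat m m" by (simp add: A_def resolvent_matrix_def)
  define t where "t = - (T *\<^sub>v ones_vec m)"
  have t: "t \<in> carrier_vec m" unfolding t_def
    using mult_mat_vec_carrier[OF T, of "ones_vec m"] by (simp add: ones_vec_def)
  define N where "N = mconst (1 - scalar_prod \<alpha> (ones_vec m)) * Determinant.det A +
    scalar_prod (map_vec mconst \<alpha>) (adj_mat A *\<^sub>v map_vec mconst t)"
  have "mph_transform m \<alpha> T K s * meval (Determinant.det A) s = meval N s" if nz: "meval (Determinant.det A) s \<noteq> 0" for s
  proof -
    interpret e: comm_ring_hom "\<lambda>F. meval F s" by (rule comm_ring_hom_meval)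
    let ?ev = "\<lambda>F. meval F s"
    define E where "E = map_mat ?ev A"
    have E: "E \<in> carrier_mat m m" using A by (simp add: E_def)
    have E_eq: "E = - T + mat_diag m (\<lambda>i. inner (K i) s)"
      using T by (intro eq_matI)
        (auto simp: E_def A_def resolvent_matrix_def e.hom_add meval_linear_form mat_diag_def)
    have det: "Determinant.det E = meval (Determinant.det A) s" unfolding E_def by (rule e.hom_det)
    have "Determinant.det E \<noteq> 0" using nz det by simp
    then have "mat_inverse E \<noteq> None"
      using mat_inverse(1)[OF E, where b = "()"] det_non_zero_imp_unit[OF E, where b = "()"] by blast
    then obtain B where B: "mat_inverse E = Some B" by blast
    note inv = mat_inverse(2)[OF E B]
    define J where "J = map_mat ?ev (adj_mat A)"
    have J: "J \<in> carrier_mat m m" using adj_mat(1)[OF A] by (simp add: J_def)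
    have "E * J = map_mat ?ev (A * adj_mat A)"
      unfolding E_def J_def by (rule e.mat_hom_mult[OF A adj_mat(1)[OF A], symmetric])
    also have "\<dots> = meval (Determinant.det A) s \<cdot>\<^sub>m 1\<^sub>m m"
      unfolding adj_mat(2)[OF A] by (intro eq_matI) (auto simp: e.hom_mult)
    finally have EJ: "E * J = meval (Determinant.det A) s \<cdot>\<^sub>m 1\<^sub>m m" .
    have "J = (B * E) * J" using inv J by simp
    also have "\<dots> = B * (E * J)" using inv E J by (intro assoc_mult_mat[of _ m m _ m _ m]) auto
    also have "\<dots> = meval (Determinant.det A) s \<cdot>\<^sub>m B"
      unfolding EJ using inv
      by (simp add: mult_smult_distrib[of _ m m _ m] right_mult_one_mat[of _ m m])
    finally have J_eq: "J = meval (Determinant.det A) s \<cdot>\<^sub>m B" .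
    have "meval (scalar_prod (map_vec mconst \<alpha>) (adj_mat A *\<^sub>v map_vec mconst t)) s =
        scalar_prod \<alpha> (J *\<^sub>v t)"
      using \<alpha> t adj_mat(1)[OF A]
      by (auto simp: scalar_prod_def e.hom_sum e.hom_mult J_def intro!: sum.cong)
    also have "\<dots> = meval (Determinant.det A) s * scalar_prod \<alpha> (B *\<^sub>v t)"
      unfolding J_eq using inv t \<alpha>
      by (auto simp: scalar_prod_def sum_distrib_left ac_simps intro!: sum.cong)
    finally show ?thesis
      unfolding mph_transform_def E_eq[symmetric] B t_def[symmetric] N_def
      by (simp add: e.hom_add e.hom_mult algebra_simps)
  qed
  then show ?thesis unfolding A_def by blast
qed


section \<open>Divisors of products of linear forms\<close>

lemma degree_grading_linear_form: "v \<noteq> 0 \<Longrightarrow> degree (grading (linear_form v)) = 1"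
  by (simp add: grading_linear_form degree_monom_eq linear_form_eq_0_iff)

text \<open>
  Linear forms are irreducible because degrees add up: a divisor of a nonzero form is a constant or
  a constant multiple of the form. As \<open>q\<close> splits along the factors of the product, the linear forms
  can be treated one at a time.
\<close>

lemma dvd_prod_linear_forms:
  fixes v :: "'i \<Rightarrow> real ^ ('n::finite)"
  assumes "finite I" and v: "\<And>i. i \<in> I \<Longrightarrow> v i \<noteq> 0 \<and> (\<forall>j. 0 \<le> vec_nth (v i) j)"
    and "\<delta> \<noteq> 0" "q dvd mconst \<delta> * (\<Prod>i\<in>I. linear_form (v i))"
  shows "\<exists>c \<nu> (lam :: nat \<Rightarrow> 'n \<Rightarrow> real). c \<noteq> 0 \<and> (\<forall>i\<in>{1..\<nu>}. \<forall>j. 0 \<le> lam i j) \<and>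
    q = mconst c * (\<Prod>i=1..\<nu>. \<Sum>j\<in>UNIV. mconst (lam i j) * mvar j)"
  using assms(1,2,4)
proof (induction I arbitrary: q rule: finite_induct)
  case empty
  have \<delta>: "mconst \<delta> \<noteq> (0 :: 'n mpoly)" using \<open>\<delta> \<noteq> 0\<close> by (simp add: mconst_eq_0_iff)
  obtain r where r: "mconst \<delta> = q * r" using empty.prems(2) by auto
  then have nz: "q \<noteq> 0" "r \<noteq> 0" using \<delta> by auto
  have "degree (grading q) = 0"
    using grading_mult_nonzero(1)[OF nz] by (simp add: r[symmetric] grading_mconst)
  then obtain c where "q = mconst c" using degree_grading_0 by blast
  moreover have "c \<noteq> 0" using nz(1) calculation by (auto simp: mconst_def)
  ultimately show ?case by (intro exI[of _ c] exI[of _ 0]) auto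
next
  case (insert i I)
  interpret c: comm_ring_hom "mconst :: real \<Rightarrow> 'n mpoly" by (rule comm_ring_hom_mconst)
  have vi: "v i \<noteq> 0" "\<And>j. 0 \<le> vec_nth (v i) j" using insert.prems(1)[of i] by auto
  have form_nz: "linear_form (v i) \<noteq> 0" using vi(1) by (simp add: linear_form_eq_0_iff)
  have dvd: "q dvd linear_form (v i) * (mconst \<delta> * (\<Prod>i\<in>I. linear_form (v i)))"
    using insert.prems(2) insert.hyps by (simp add: mult.left_commute)
  have "q \<noteq> 0"
  proof
    assume "q = 0"
    then have "linear_form (v i) * (mconst \<delta> * (\<Prod>i\<in>I. linear_form (v i))) = 0" using dvd by simp
    moreover have "(\<Prod>i\<in>I. linear_form (v i)) \<noteq> 0"
      using insert.hyps(1) insert.prems(1) by (intro prod_linear_forms_nonzero) auto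
    moreover have "mconst \<delta> \<noteq> (0 :: 'n mpoly)"
      using \<open>\<delta> \<noteq> 0\<close> by (simp add: mconst_eq_0_iff)
    ultimately show False using form_nz by (simp add: mpoly_mult_eq_0_iff)
  qed
  from mpoly_dvd_mult_decompose[OF this dvd] obtain q1 q2 where
    q: "q = q1 * q2" "q1 dvd linear_form (v i)" "q2 dvd mconst \<delta> * (\<Prod>i\<in>I. linear_form (v i))"
    by blast
  have "v k \<noteq> 0 \<and> (\<forall>j. 0 \<le> vec_nth (v k) j)" if "k \<in> I" for k
    using insert.prems(1) that by blast
  from insert.IH[OF this q(3)] obtain c \<nu> and lam :: "nat \<Rightarrow> 'n \<Rightarrow> real" where
    q2: "c \<noteq> 0" "\<forall>i\<in>{1..\<nu>}. \<forall>j. 0 \<le> lam i j"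
      "q2 = mconst c * (\<Prod>i=1..\<nu>. \<Sum>j\<in>UNIV. mconst (lam i j) * mvar j)"
    by blast
  obtain r where r: "linear_form (v i) = q1 * r" using q(2) by (rule dvdE)
  have nz: "q1 \<noteq> 0" "r \<noteq> 0" using form_nz r by auto
  have "degree (grading q1) + degree (grading r) = 1"
    using grading_mult_nonzero(1)[OF nz] degree_grading_linear_form[OF vi(1)] by (simp add: r)
  then consider "degree (grading q1) = 0" | "degree (grading r) = 0" by linarith
  then show ?case
  proof cases
    case 1
    then obtain e where e: "q1 = mconst e" using degree_grading_0 by blast
    then have "e \<noteq> 0" using nz by auto
    moreover have "q = mconst (e * c) * (\<Prod>i=1..\<nu>. \<Sum>j\<in>UNIV. mconst (lam i j) * mvar j)"
      by (simp add: q(1) e q2(3) c.hom_mult mult.assoc)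
    ultimately show ?thesis
      using q2(1,2) by (intro exI[of _ "e * c"] exI[of _ \<nu>] exI[of _ lam]) auto
  next
    case 2
    then obtain e where e: "r = mconst e" using degree_grading_0 by blast
    then have "e \<noteq> 0" using nz by auto
    \<comment> \<open>The form split off becomes the last factor.\<close>
    define lam' where "lam' = lam(Suc \<nu> := vec_nth (v i))"
    have "q1 = q1 * (mconst e * mconst (inverse e))"
      using \<open>e \<noteq> 0\<close> by (simp flip: c.hom_mult)
    also have "\<dots> = mconst (inverse e) * linear_form (v i)" by (simp add: r e ac_simps)
    finally have q1: "q1 = mconst (inverse e) * linear_form (v i)" .
    have "(\<Prod>i=1..Suc \<nu>. \<Sum>j\<in>UNIV. mconst (lam' i j) * mvar j) =
        (\<Prod>i=1..\<nu>. \<Sum>j\<in>UNIV. mconst (lam i j) * mvar j) * linear_form (v i)"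
      by (simp add: lam'_def linear_form_def)
    then have "q = mconst (inverse e * c) * (\<Prod>i=1..Suc \<nu>. \<Sum>j\<in>UNIV. mconst (lam' i j) * mvar j)"
      by (simp only: q(1) q1 q2(3) c.hom_mult ac_simps)
    moreover have "\<forall>i\<in>{1..Suc \<nu>}. \<forall>j. 0 \<le> lam' i j"
      using q2(2) vi(2) by (auto simp: lam'_def)
    ultimately show ?thesis
      using q2(1) \<open>e \<noteq> 0\<close>
      by (intro exI[of _ "inverse e * c"] exI[of _ "Suc \<nu>"] exI[of _ lam'] conjI) auto
  qed
qed

section \<open>The minimal denominator\<close>

lemma minimal_form_scale:
  fixes P Q :: "('n::finite) mpoly"
  assumes "minimal_form L P Q" "c \<noteq> 0"
  shows "minimal_form L (mconst c * P) (mconst c * Q)"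
proof -
  interpret c: comm_ring_hom "mconst :: real \<Rightarrow> 'n mpoly" by (rule comm_ring_hom_mconst)
  have unit: "mconst (inverse c) * (mconst c * F) = F" for F :: "'n mpoly"
    using \<open>c \<noteq> 0\<close> by (simp flip: mult.assoc c.hom_mult)
  have meval: "meval (mconst c * F) s = c * meval F s" for F :: "'n mpoly" and s
  proof -
    interpret e: comm_ring_hom "\<lambda>F. meval F s" by (rule comm_ring_hom_meval)
    show ?thesis by (simp add: e.hom_mult)
  qed
  have dvd: "D dvd F" if "D dvd mconst c * F" for D F :: "'n mpoly"
    using dvd_mult[OF that, of "mconst (inverse c)"] unfolding unit .
  show ?thesis
    unfolding minimal_form_def
  proof (intro conjI ballI allI impI)
    show "mconst c * Q \<noteq> 0" using assms unit[of Q] by (auto simp: minimal_form_def)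
    fix s :: "real ^ 'n" assume "s \<in> nonneg_orthant" "meval (mconst c * Q) s \<noteq> 0"
    then show "L s = meval (mconst c * P) s / meval (mconst c * Q) s"
      using assms by (simp add: minimal_form_def meval)
  next
    fix D assume "D dvd mconst c * P" "D dvd mconst c * Q"
    then have "D dvd P" "D dvd Q" by (auto intro: dvd)
    then show "\<exists>d. D = mconst d" using assms(1) unfolding minimal_form_def by blast
  qed
qed

text \<open>
  Two representations of \<open>L\<close> as a fraction give \<open>P D = Q N\<close>: the difference, multiplied by \<open>Q D\<close> to
  cover the zeros of the denominators, vanishes on the orthant. So \<open>Q\<close> divides \<open>P D\<close>, and the part of
  \<open>Q\<close> that divides \<open>P\<close> is a common divisor of \<open>P\<close> and \<open>Q\<close> and thus constant.
\<close>

lemma minimal_denominator_dvd: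
  fixes P Q D N :: "('n::finite) mpoly"
  assumes min: "minimal_form L P Q"
    and "D \<noteq> 0" and L: "\<And>s. s \<in> nonneg_orthant \<Longrightarrow> meval D s \<noteq> 0 \<Longrightarrow> L s * meval D s = meval N s"
  shows "Q dvd D"
proof -
  have Q: "Q \<noteq> 0" and PQ: "\<And>s. s \<in> nonneg_orthant \<Longrightarrow> meval Q s \<noteq> 0 \<Longrightarrow> L s = meval P s / meval Q s"
    and coprime: "\<And>E. E dvd P \<Longrightarrow> E dvd Q \<Longrightarrow> \<exists>c. E = mconst c"
    using min by (auto simp: minimal_form_def)
  have "(P * D - Q * N) * (Q * D) = 0"
  proof (rule mpoly_eq_0I)
    fix s :: "real ^ 'n" assume s: "s \<in> nonneg_orthant"
    interpret e: comm_ring_hom "\<lambda>F. meval F s" by (rule comm_ring_hom_meval)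
    show "meval ((P * D - Q * N) * (Q * D)) s = 0"
    proof (cases "meval Q s = 0 \<or> meval D s = 0")
      case False
      then have "meval P s / meval Q s * meval D s = meval N s"
        using PQ[OF s] L[OF s] by simp
      then show ?thesis using False by (simp add: e.hom_mult e.hom_minus field_simps)
    qed (auto simp: e.hom_mult)
  qed
  then have "P * D = Q * N" using Q \<open>D \<noteq> 0\<close> by (simp add: mpoly_mult_eq_0_iff)
  then have "Q dvd P * D" by simp
  from mpoly_dvd_mult_decompose[OF Q this] obtain q1 q2 where
    q: "Q = q1 * q2" "q1 dvd P" "q2 dvd D" by blast
  then obtain c where c: "q1 = mconst c" using coprime[of q1] by auto
  interpret c: comm_ring_hom "mconst :: real \<Rightarrow> 'n mpoly" by (rule comm_ring_hom_mconst)
  have "c \<noteq> 0" using Q q(1) c by auto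
  then have "q1 dvd 1"
    unfolding c by (intro dvdI[of _ _ "mconst (inverse c)"]) (simp flip: c.hom_mult)
  then have "q1 * q2 dvd 1 * D" using q(3) by (rule mult_dvd_mono)
  then show ?thesis by (simp add: q(1))
qed

theorem theorem4p2:
  fixes M :: "'a measure"
    and Y :: "'a \<Rightarrow> real ^ 'n"
    and P Q :: "'n mpoly"
  assumes "2 \<le> CARD('n)"
    and "MPH_star M Y"
    and "minimal_form (laplace_transform M Y) P Q"
  shows "\<exists>c::real. c \<noteq> 0 \<and>
    minimal_form (laplace_transform M Y) (mconst c * P) (mconst c * Q) \<and>
    (\<exists>(c0::real) (\<nu>::nat) (lam :: nat \<Rightarrow> 'n \<Rightarrow> real).
       0 < c0 \<and>
       (\<forall>i\<in>{1..\<nu>}. \<forall>j. 0 \<le> lam i j) \<and>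
       leading_part (mconst c * Q) =
         mconst c0 * (\<Prod>i=1..\<nu>. \<Sum>j\<in>UNIV. mconst (lam i j) * mvar j))"
proof -
  interpret c: comm_ring_hom "mconst :: real \<Rightarrow> 'n mpoly" by (rule comm_ring_hom_mconst)
  obtain m \<alpha> T and K :: "nat \<Rightarrow> real ^ 'n" where
    \<alpha>: "\<alpha> \<in> carrier_vec m" and T: "transient_subgenerator m T"
    and K: "\<And>i j. i < m \<Longrightarrow> 0 \<le> vec_nth (K i) j"
    and L: "\<And>s. s \<in> nonneg_orthant \<Longrightarrow> laplace_transform M Y s = mph_transform m \<alpha> T K s"
    using assms(2) unfolding MPH_star_def by blast
  define D where "D = Determinant.det (resolvent_matrix m T K)"
  have "D \<noteq> 0" unfolding D_def by (rule leading_part_det_resolvent_matrix(1)[OF T])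
  obtain \<delta> where \<delta>: "\<delta> \<noteq> 0"
    "leading_part D = mconst \<delta> * (\<Prod>i | i < m \<and> K i \<noteq> 0. linear_form (K i))"
    using leading_part_det_resolvent_matrix(2)[OF T, of K] unfolding D_def by blast
  have "T \<in> carrier_mat m m" using T by (simp add: transient_subgenerator_def)
  from mph_transform_rational[OF \<alpha> this, of K] obtain N where
    N: "\<And>s. meval D s \<noteq> 0 \<Longrightarrow> mph_transform m \<alpha> T K s * meval D s = meval N s"
    unfolding D_def by blast
  have "Q dvd D"
    by (rule minimal_denominator_dvd[OF assms(3) \<open>D \<noteq> 0\<close>]) (simp add: L N)
  then obtain R where R: "D = Q * R" by (rule dvdE)
  have nz: "Q \<noteq> 0" "R \<noteq> 0" using R \<open>D \<noteq> 0\<close> by auto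
  have lead_dvd: "leading_part Q dvd mconst \<delta> * (\<Prod>i | i < m \<and> K i \<noteq> 0. linear_form (K i))"
    using grading_mult_nonzero(2)[OF nz] by (simp add: R[symmetric] \<delta>(2)[symmetric])
  have "finite {i. i < m \<and> K i \<noteq> 0}" by simp
  moreover have "K i \<noteq> 0 \<and> (\<forall>j. 0 \<le> vec_nth (K i) j)" if "i \<in> {i. i < m \<and> K i \<noteq> 0}" for i
    using K that by blast
  ultimately obtain c \<nu> and lam :: "nat \<Rightarrow> 'n \<Rightarrow> real" where c: "c \<noteq> 0" "\<forall>i\<in>{1..\<nu>}. \<forall>j. 0 \<le> lam i j"
    "leading_part Q = mconst c * (\<Prod>i=1..\<nu>. \<Sum>j\<in>UNIV. mconst (lam i j) * mvar j)"
    using dvd_prod_linear_forms[OF _ _ \<delta>(1) lead_dvd] by blast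
  \<comment> \<open>Dividing by the constant \<open>c\<close> of \<^term>\<open>leading_part Q\<close> normalizes \<open>c0\<close> to 1.\<close>
  have "mconst (inverse c) \<noteq> (0 :: 'n mpoly)"
    using c(1) by (simp add: mconst_eq_0_iff)
  then have "leading_part (mconst (inverse c) * Q) = mconst (inverse c) * leading_part Q"
    using grading_mult_nonzero(2)[OF _ nz(1)] by (simp add: leading_part_eq_lead_coeff grading_mconst)
  also have "\<dots> = mconst 1 * (\<Prod>i=1..\<nu>. \<Sum>j\<in>UNIV. mconst (lam i j) * mvar j)"
    unfolding c(3) using c(1) by (simp flip: mult.assoc c.hom_mult)
  finally have "leading_part (mconst (inverse c) * Q) =
      mconst 1 * (\<Prod>i=1..\<nu>. \<Sum>j\<in>UNIV. mconst (lam i j) * mvar j)" .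
  moreover have "minimal_form (laplace_transform M Y) (mconst (inverse c) * P) (mconst (inverse c) * Q)"
    using minimal_form_scale[OF assms(3)] c(1) by simp
  moreover have "inverse c \<noteq> 0" "(0::real) < 1" using c(1) by simp_all
  ultimately show ?thesis using c(2) by blast
qed

end
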